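(* Let $n,b,w$ be non-negative integers with $b+w=n+2$. Let $P_{n+2}^{\to}$ be a convex polygon with $n+2$ vertices together with a marked oriented boundary edge $\vec e$. (i) The number of triangulations of $P_{n+2}^{\to}$ such that, in the uniquely determined colouring of the vertices with the two colours black and white in which both endpoints of $\vec e$ are white and every triangle has exactly two white vertices and one black vertex, there are $b$ black and $w$ white vertices, equals $$\frac{2b}{(w-1)(2b+w-2)}\binom{2b+w-2}{w-2}\binom{w-1}{b}.$$ (ii) The number of triangulations of $P_{n+2}^{\to}$ such that, in the uniquely determined colouring of the vertices with black and white in which the starting vertex of $\vec e$ is white, its ending vertex is black, and every triangle has exactly two white vertices and one black vertex, there are $b$ black and $w$ white vertices, equals $$\frac{1}{2b+w-2}\binom{2b+w-2}{w-1}\binom{w-1}{b-1}.$$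
   Context: A convex polygon means one all of whose angles are less than 180 degrees; only the combinatorics matters, so for each $n$ one fixed polygon $P_{n+2}$ is considered, and $P_{n+2}^{\to}$ denotes it with a marked oriented boundary edge. A triangulation of $P_{n+2}$ (using only the polygon's vertices) has exactly $n$ triangles; for $n=0$ the polygon degenerates to the marked edge and there is by convention exactly one triangulation. For each triangulation, each of the two colourings described in (i) and (ii) exists and is unique (it arises from the unique proper 3-colouring of the vertices, in which each triangle has three distinct colours, by merging two of the colour classes).
   Formalization: The printed fractions are undefined (division by zero) in (i) for w=1 and for b=0, w=2, and in (ii) for b=0, w=2; the formulas are stated wherever the denominator is nonzero, and the counts in these cases are given separately: (i) w=1: 0; (i) b=0, w=2: 1; (ii) b=0, w=2: 0. *)

theory Defs
  imports Complex_Main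
begin

text \<open>
  The vertices of the polygon with \<open>n + 2\<close> vertices are \<open>0, \<dots>, n + 1\<close> in cyclic order.
  For \<open>n = 0\<close> the only boundary edge is \<open>{0, 1}\<close>.
\<close>

definition vertices :: "nat \<Rightarrow> nat set" where
  "vertices n = {0..<n + 2}"

definition boundary_edges :: "nat \<Rightarrow> nat set set" where
  "boundary_edges n = {{i, (i + 1) mod (n + 2)} | i. i < n + 2}"

definition diagonals :: "nat \<Rightarrow> nat set set" where
  "diagonals n = {d. d \<subseteq> vertices n \<and> card d = 2} - boundary_edges n"

text \<open>
  In a convex polygon two diagonals meet in an interior point iff their four endpoints are
  distinct and alternate in the cyclic order.
\<close>

definition crossing :: "nat set \<Rightarrow> nat set \<Rightarrow> bool" where
  "crossing d e \<longleftrightarrow>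
     (\<exists>i j k l. i < j \<and> j < k \<and> k < l \<and> (d = {i, k} \<and> e = {j, l} \<or> d = {j, l} \<and> e = {i, k}))"

text \<open>
  A triangulation is given by its set of diagonals: a maximal set of pairwise non-crossing ones.
  For \<open>n = 0\<close> and \<open>n = 1\<close> it is the empty set.
\<close>

definition triangulation :: "nat \<Rightarrow> nat set set \<Rightarrow> bool" where
  "triangulation n T \<longleftrightarrow>
     T \<subseteq> diagonals n \<and>
     (\<forall>d\<in>T. \<forall>e\<in>T. \<not> crossing d e) \<and>
     (\<forall>d\<in>diagonals n - T. \<exists>e\<in>T. crossing d e)"

text \<open>
  The polygon has no vertices in its interior, so three pairwise joined vertices always bound a
  face of the triangulation.
\<close>

definition triangles :: "nat \<Rightarrow> nat set set \<Rightarrow> nat set set" where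
  "triangles n T =
     {t. t \<subseteq> vertices n \<and> card t = 3 \<and>
         (\<forall>x\<in>t. \<forall>y\<in>t. x \<noteq> y \<longrightarrow> {x, y} \<in> boundary_edges n \<union> T)}"

text \<open>A black-white colouring of the vertices is given by the set \<open>B\<close> of black vertices.\<close>

definition bw_colouring :: "nat \<Rightarrow> nat set set \<Rightarrow> nat set \<Rightarrow> bool" where
  "bw_colouring n T B \<longleftrightarrow>
     B \<subseteq> vertices n \<and> (\<forall>t\<in>triangles n T. card (t - B) = 2 \<and> card (t \<inter> B) = 1)"

text \<open>Below, \<open>s\<close> and \<open>e\<close> are the start and the end of the marked oriented boundary edge.\<close>

definition ww_colouring :: "nat \<Rightarrow> nat \<Rightarrow> nat \<Rightarrow> nat set set \<Rightarrow> nat set \<Rightarrow> bool" where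
  "ww_colouring n s e T B \<longleftrightarrow> bw_colouring n T B \<and> s \<notin> B \<and> e \<notin> B"

definition wb_colouring :: "nat \<Rightarrow> nat \<Rightarrow> nat \<Rightarrow> nat set set \<Rightarrow> nat set \<Rightarrow> bool" where
  "wb_colouring n s e T B \<longleftrightarrow> bw_colouring n T B \<and> s \<notin> B \<and> e \<in> B"

definition ww_triangulations :: "nat \<Rightarrow> nat \<Rightarrow> nat \<Rightarrow> nat \<Rightarrow> nat \<Rightarrow> nat set set set" where
  "ww_triangulations n s e b w =
     {T. triangulation n T \<and>
         (\<exists>B. ww_colouring n s e T B \<and> card B = b \<and> card (vertices n - B) = w)}"

definition wb_triangulations :: "nat \<Rightarrow> nat \<Rightarrow> nat \<Rightarrow> nat \<Rightarrow> nat \<Rightarrow> nat set set set" where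
  "wb_triangulations n s e b w =
     {T. triangulation n T \<and>
         (\<exists>B. wb_colouring n s e T B \<and> card B = b \<and> card (vertices n - B) = w)}"

text \<open>
  Binomial coefficient with integer arguments, zero for a negative lower argument; arguments such
  as \<open>w - 2\<close> can be negative and must not be truncated.
\<close>

definition binom :: "int \<Rightarrow> int \<Rightarrow> real" where
  "binom m k = (if k < 0 then 0 else real_of_int m gchoose nat k)"

end

theory Submission
  imports Defs "HOL-Computational_Algebra.Formal_Power_Series"
begin

text \<open>
  The triangle on the marked edge splits a triangulated polygon into two smaller ones whose marked
  edges have their end colours determined by those of the original edge. Let \<open>A\<close> and \<open>D\<close> be the
  generating functions for a white-white and a white-black marked edge, where \<open>z\<close> marks every vertex
  off the marked edge and \<open>x\<close> the black ones among them. Then \<open>A = 1 + x z D\<^sup>2\<close> and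
  \<open>D = 1 + z A D\<close>. Multiplying \<open>D = 1 + z D + x z\<^sup>2 D\<^sup>3\<close> by \<open>D\<^sup>r\<close> gives a recursion in \<open>r\<close> for the
  coefficients of all powers of \<open>D\<close>, which the closed forms predicted by Lagrange inversion satisfy.
\<close>

text \<open>The cubic equation alone gives no linear recursion for the coefficients of D; for all
  powers at once it does. The coefficient of \<open>z^N\<close> in \<open>D^(r+1)\<close> comes from
  that of \<open>D^r\<close> at the same \<open>N\<close> and from powers of D at
  \<open>N - 1\<close> and \<open>N - 2\<close>, and \<open>D^0 = 1\<close>. Induction on
  \<open>N\<close>, with an inner one on \<open>r\<close>, then leaves one binomial identity.

  Origin of the closed form: let \<open>y = z\<close> record a white and \<open>X = x z\<close> a
  black vertex, so that \<open>D = 1 + y D (1 + X D^2)\<close>. With \<open>D = 1 + u\<close>, the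
  coefficient of \<open>y^k\<close> in \<open>D^r\<close> is \<open>r / k\<close> times that of
  \<open>u^(k-1)\<close> in \<open>(1 + u)^(r+k-1) (1 + X (1 + u)^2)^k\<close>; then
  \<open>X^j\<close> is extracted. Part (ii) is the case \<open>r = 1\<close>, part (i) the case
  \<open>r = 2\<close>, because A - 1 is x z times the square of D.

  The recursion needs a class of polygons closed under cutting: intervals \<open>{a..c}\<close>
  whose outer chord is the marked edge. An arbitrary boundary edge is rotated into this position; it
  may arrive reversed, and then the symmetry of the white-black series is used.\<close>

unbundle fps_syntax

section \<open>Triangulations of an interval of vertices\<close>

definition chords :: "nat \<Rightarrow> nat \<Rightarrow> (nat \<times> nat) set" where
  "chords a c = {(x, y). a \<le> x \<and> x < y \<and> y \<le> c}"

definition crosses :: "nat \<times> nat \<Rightarrow> nat \<times> nat \<Rightarrow> bool" where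
  "crosses p q \<longleftrightarrow>
     fst p < fst q \<and> fst q < snd p \<and> snd p < snd q \<or> fst q < fst p \<and> fst p < snd q \<and> snd q < snd p"

text \<open>Unlike in the definitions, the boundary edges belong to a full triangulation. The fixed point
  equation says that \<open>U\<close> is non-crossing and maximal.\<close>

definition full_triangulations :: "nat \<Rightarrow> nat \<Rightarrow> (nat \<times> nat) set set" where
  "full_triangulations a c = {U. U = {p \<in> chords a c. \<forall>q\<in>U. \<not> crosses p q}}"

definition one_of_three :: "nat set \<Rightarrow> nat \<Rightarrow> nat \<Rightarrow> nat \<Rightarrow> bool" where
  "one_of_three B x y z \<longleftrightarrow>
     x \<in> B \<and> y \<notin> B \<and> z \<notin> B \<or> x \<notin> B \<and> y \<in> B \<and> z \<notin> B \<or> x \<notin> B \<and> y \<notin> B \<and> z \<in> B"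

text \<open>Pairs in a full triangulation are increasing, so each triangle is met once, with
  \<open>y\<close> its middle vertex.\<close>

definition proper :: "(nat \<times> nat) set \<Rightarrow> nat set \<Rightarrow> bool" where
  "proper U B \<longleftrightarrow>
     (\<forall>x y z. (x, y) \<in> U \<longrightarrow> (y, z) \<in> U \<longrightarrow> (x, z) \<in> U \<longrightarrow> one_of_three B x y z)"

text \<open>\<open>True\<close> stands for black, and the chord from \<open>a\<close> to
  \<open>c\<close> plays the marked edge. Pairs are collected so that cutting acts on triangulation
  and colouring together; \<open>coloured_unique\<close> later turns a count of pairs into a count
  of triangulations.\<close>

definition coloured :: "bool \<Rightarrow> bool \<Rightarrow> nat \<Rightarrow> nat \<Rightarrow> ((nat \<times> nat) set \<times> nat set) set" where
  "coloured \<alpha> \<gamma> a c =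
     {(U, B). U \<in> full_triangulations a c \<and> B \<subseteq> {a..c} \<and> proper U B \<and>
        (a \<in> B) = \<alpha> \<and> (c \<in> B) = \<gamma>}"

lemma chords_iff: "(x, y) \<in> chords a c \<longleftrightarrow> a \<le> x \<and> x < y \<and> y \<le> c"
  by (simp add: chords_def)

lemma crosses_iff:
  "crosses (x, y) (u, v) \<longleftrightarrow> x < u \<and> u < y \<and> y < v \<or> u < x \<and> x < v \<and> v < y"
  by (simp add: crosses_def)

lemma crosses_sym: "crosses p q \<longleftrightarrow> crosses q p"
  by (auto simp: crosses_def)

lemma finite_chords: "finite (chords a c)"
  by (rule finite_subset[of _ "{a..c} \<times> {a..c}"]) (auto simp: chords_def)

lemma full_triangulations_iff:
  "U \<in> full_triangulations a c \<longleftrightarrow>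
     (\<forall>x y. (x, y) \<in> U \<longleftrightarrow> a \<le> x \<and> x < y \<and> y \<le> c \<and> (\<forall>q\<in>U. \<not> crosses (x, y) q))"
  unfolding full_triangulations_def by (auto simp: chords_def set_eq_iff)

lemma mem_full_triangulation:
  "U \<in> full_triangulations a c \<Longrightarrow>
     (x, y) \<in> U \<longleftrightarrow> a \<le> x \<and> x < y \<and> y \<le> c \<and> (\<forall>q\<in>U. \<not> crosses (x, y) q)"
  unfolding full_triangulations_iff by blast

lemma full_triangulation_range:
  assumes "U \<in> full_triangulations a c" "(x, y) \<in> U"
  shows "a \<le> x" "x < y" "y \<le> c"
  using mem_full_triangulation[OF assms(1), of x y] assms(2) by auto

lemma full_triangulation_subset:
  "U \<in> full_triangulations a c \<Longrightarrow> U \<subseteq> chords a c"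
  unfolding full_triangulations_def by blast

lemma finite_full_triangulations: "finite (full_triangulations a c)"
  by (rule finite_subset[of _ "Pow (chords a c)"])
     (auto simp: finite_chords dest: full_triangulation_subset)

lemma full_triangulation_noncrossing:
  assumes "U \<in> full_triangulations a c" "p \<in> U" "q \<in> U"
  shows "\<not> crosses p q"
  using mem_full_triangulation[OF assms(1), of "fst p" "snd p"] assms(2,3) by auto

text \<open>No chord of the interval has an endpoint outside it, so nothing crosses the outer chord
  and maximality forces it in.\<close>

lemma full_triangulation_base:
  assumes "U \<in> full_triangulations a c" "a < c"
  shows "(a, c) \<in> U"
proof -
  have "\<not> crosses (a, c) q" if "q \<in> U" for q
    using full_triangulation_range[OF assms(1), of "fst q" "snd q"] that
    by (auto simp: crosses_def)
  then show ?thesis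
    using mem_full_triangulation[OF assms(1), of a c] assms(2) by auto
qed

lemma full_triangulation_step:
  assumes "U \<in> full_triangulations a c" "a \<le> x" "x < c"
  shows "(x, Suc x) \<in> U"
proof -
  have "\<not> crosses (x, Suc x) q" if "q \<in> U" for q
    by (auto simp: crosses_def)
  then show ?thesis
    using mem_full_triangulation[OF assms(1), of x "Suc x"] assms(2,3) by auto
qed

lemma full_triangulations_Suc: "full_triangulations a (Suc a) = {{(a, Suc a)}}"
proof -
  have ch: "chords a (Suc a) = {(a, Suc a)}"
    by (auto simp: chords_def)
  have "{(a, Suc a)} \<in> full_triangulations a (Suc a)"
    by (auto simp: full_triangulations_iff crosses_iff)
  moreover have "U = {(a, Suc a)}" if "U \<in> full_triangulations a (Suc a)" for U
    using full_triangulation_base[OF that] full_triangulation_subset[OF that] ch by auto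
  ultimately show ?thesis
    by blast
qed

text \<open>A chord leaving \<open>{x..y}\<close> that crossed one inside would also cross
  \<open>(x, y)\<close>. Hence only chords inside the interval matter for maximality there.\<close>

lemma full_triangulation_restrict:
  assumes U: "U \<in> full_triangulations a c" and xy: "(x, y) \<in> U"
  shows "U \<inter> chords x y \<in> full_triangulations x y"
  unfolding full_triangulations_iff
proof (intro allI iffI)
  fix u v
  assume "(u, v) \<in> U \<inter> chords x y"
  then show "x \<le> u \<and> u < v \<and> v \<le> y \<and> (\<forall>q\<in>U \<inter> chords x y. \<not> crosses (u, v) q)"
    using full_triangulation_noncrossing[OF U] by (auto simp: chords_iff)
next
  fix u v
  assume h: "x \<le> u \<and> u < v \<and> v \<le> y \<and> (\<forall>q\<in>U \<inter> chords x y. \<not> crosses (u, v) q)"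
  have "\<not> crosses (u, v) (p, q)" if pq: "(p, q) \<in> U" for p q
  proof (cases "(p, q) \<in> chords x y")
    case True
    then show ?thesis using h pq by blast
  next
    case False
    have "\<not> crosses (x, y) (p, q)"
      using full_triangulation_noncrossing[OF U xy pq] .
    then show ?thesis
      using False h full_triangulation_range[OF U pq]
      unfolding crosses_iff chords_iff by linarith
  qed
  then have "(u, v) \<in> U"
    using mem_full_triangulation[OF U, of u v] h full_triangulation_range[OF U xy] by auto
  then show "(u, v) \<in> U \<inter> chords x y"
    using h by (auto simp: chords_iff)
qed

section \<open>Cutting at the apex over the outer chord\<close>

lemma full_triangulation_apex:
  assumes U: "U \<in> full_triangulations a c" and ac: "Suc a < c"
  shows "\<exists>m. a < m \<and> m < c \<and> (a, m) \<in> U \<and> (m, c) \<in> U"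
proof -
  define X where "X = {x. a < x \<and> x < c \<and> (a, x) \<in> U}"
  have "finite X" unfolding X_def by (rule finite_subset[of _ "{..c}"]) auto
  have "Suc a \<in> X"
    using full_triangulation_step[OF U, of a] ac by (auto simp: X_def)
  \<comment> \<open>The apex is the last neighbour of \<open>a\<close> before \<open>c\<close>. A
    chord crossing \<open>(m, c)\<close> either starts at \<open>a\<close>, against the choice of
    \<open>m\<close>, or strictly between \<open>a\<close> and \<open>m\<close>, and then it crosses
    \<open>(a, m)\<close>.\<close>
  define m where "m = Max X"
  have mX: "m \<in> X"
    unfolding m_def using \<open>finite X\<close> \<open>Suc a \<in> X\<close> by (intro Max_in) auto
  have mmax: "x \<le> m" if "x \<in> X" for x
    unfolding m_def using \<open>finite X\<close> that by simp
  have am: "a < m" "m < c" "(a, m) \<in> U" using mX by (auto simp: X_def)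
  have "\<not> crosses (m, c) (x, y)" if xy: "(x, y) \<in> U" for x y
  proof
    assume "crosses (m, c) (x, y)"
    then have 1: "x < m" "m < y" "y < c"
      using full_triangulation_range[OF U xy] by (auto simp: crosses_iff)
    have "\<not> crosses (a, m) (x, y)"
      using full_triangulation_noncrossing[OF U am(3) xy] .
    then have "x = a"
      using 1 full_triangulation_range[OF U xy] by (auto simp: crosses_iff)
    then have "y \<in> X"
      using xy 1 am by (auto simp: X_def)
    then show False using mmax[of y] 1 by simp
  qed
  then have "(m, c) \<in> U"
    using mem_full_triangulation[OF U, of m c] am by auto
  then show ?thesis using am by blast
qed

text \<open>For \<open>m < k\<close> the chords \<open>(a, k)\<close> and \<open>(m, c)\<close>
  would cross.\<close>

lemma full_triangulation_apex_unique:
  assumes U: "U \<in> full_triangulations a c"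
    and "(a, m) \<in> U" "(m, c) \<in> U" "(a, k) \<in> U" "(k, c) \<in> U"
  shows "m = k"
  using full_triangulation_noncrossing[OF U assms(2) assms(5)]
    full_triangulation_noncrossing[OF U assms(4) assms(3)]
    full_triangulation_range[OF U assms(2)] full_triangulation_range[OF U assms(3)]
    full_triangulation_range[OF U assms(4)] full_triangulation_range[OF U assms(5)]
  by (auto simp: crosses_iff)

text \<open>A chord passing over \<open>m\<close> must start at \<open>a\<close>, or it crosses
  \<open>(a, m)\<close>, and must end at \<open>c\<close>, or it crosses \<open>(m, c)\<close>; only
  the outer chord does both.\<close>

lemma full_triangulation_split:
  assumes U: "U \<in> full_triangulations a c" and am: "(a, m) \<in> U" and mc: "(m, c) \<in> U"
  shows "U = insert (a, c) (U \<inter> chords a m \<union> U \<inter> chords m c)"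
proof -
  have "(a, c) \<in> U"
    using full_triangulation_base[OF U] full_triangulation_range[OF U am]
      full_triangulation_range[OF U mc] by simp
  moreover have "(x, y) = (a, c) \<or> (x, y) \<in> chords a m \<or> (x, y) \<in> chords m c"
    if xy: "(x, y) \<in> U" for x y
    using full_triangulation_noncrossing[OF U am xy] full_triangulation_noncrossing[OF U mc xy]
      full_triangulation_range[OF U xy] by (auto simp: crosses_iff chords_iff)
  ultimately show ?thesis by auto
qed

lemma full_triangulation_glue:
  assumes U1: "U1 \<in> full_triangulations a m" and U2: "U2 \<in> full_triangulations m c"
    and m: "a < m" "m < c"
  shows "insert (a, c) (U1 \<union> U2) \<in> full_triangulations a c"
  unfolding full_triangulations_iff
proof (intro allI iffI)
  have r1: "a \<le> x \<and> x < y \<and> y \<le> m" if "(x, y) \<in> U1" for x y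
    using full_triangulation_range[OF U1 that] by simp
  have r2: "m \<le> x \<and> x < y \<and> y \<le> c" if "(x, y) \<in> U2" for x y
    using full_triangulation_range[OF U2 that] by simp
  note n1 = full_triangulation_noncrossing[OF U1] and n2 = full_triangulation_noncrossing[OF U2]
  let ?U = "insert (a, c) (U1 \<union> U2)"
  {
    fix x y
    assume xy: "(x, y) \<in> ?U"
    have "\<not> crosses (x, y) (u, v)" if uv: "(u, v) \<in> ?U" for u v
    proof -
      \<comment> \<open>Chords from different sides share at most the vertex \<open>m\<close>, and
        nothing crosses the outer chord; what remains are pairs on the same side.\<close>
      consider "x = a" "y = c" | "(x, y) \<in> U1" | "(x, y) \<in> U2" using xy by auto
      note xy_cases = this
      consider "u = a" "v = c" | "(u, v) \<in> U1" | "(u, v) \<in> U2" using uv by auto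
      then show ?thesis
        using m by (cases; cases rule: xy_cases)
          (auto simp: n1 n2, auto simp: crosses_iff dest!: r1 r2)
    qed
    moreover have "a \<le> x \<and> x < y \<and> y \<le> c"
      using xy m by (auto dest!: r1 r2)
    ultimately show "a \<le> x \<and> x < y \<and> y \<le> c \<and> (\<forall>q\<in>?U. \<not> crosses (x, y) q)"
      by auto
  }
  fix x y
  assume h: "a \<le> x \<and> x < y \<and> y \<le> c \<and> (\<forall>q\<in>?U. \<not> crosses (x, y) q)"
  \<comment> \<open>The sides \<open>(a, m)\<close> and \<open>(m, c)\<close> already belong to the
    pieces. Not crossing them confines a chord to one side or makes it the outer chord.\<close>
  have am: "(a, m) \<in> U1" and mc: "(m, c) \<in> U2"
    using full_triangulation_base U1 U2 m by auto
  then have "\<not> crosses (x, y) (a, m)" "\<not> crosses (x, y) (m, c)"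
    using h by auto
  then consider "y \<le> m" | "m \<le> x" | "x = a" "y = c"
    using h unfolding crosses_iff by linarith
  then show "(x, y) \<in> ?U"
  proof cases
    case 1
    then show ?thesis using h mem_full_triangulation[OF U1, of x y] by auto
  next
    case 2
    then show ?thesis using h mem_full_triangulation[OF U2, of x y] by auto
  next
    case 3
    then show ?thesis by simp
  qed
qed

section \<open>Colourings under the cut\<close>

lemma proper_split:
  assumes U: "U \<in> full_triangulations a c" and am: "(a, m) \<in> U" and mc: "(m, c) \<in> U"
  shows "proper U B \<longleftrightarrow> one_of_three B a m c \<and>
           proper (U \<inter> chords a m) (B \<inter> {a..m}) \<and> proper (U \<inter> chords m c) (B \<inter> {m..c})"
proof
  note r = full_triangulation_range[OF U]
  have ac: "(a, c) \<in> U"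
    using full_triangulation_base[OF U] r(2)[OF am] r(2)[OF mc] by simp
  {
    assume P: "proper U B"
    have "proper (U \<inter> chords p q) (B \<inter> {p..q})" for p q
      unfolding proper_def
    proof (intro allI impI)
      fix x y z
      assume "(x, y) \<in> U \<inter> chords p q" "(y, z) \<in> U \<inter> chords p q" "(x, z) \<in> U \<inter> chords p q"
      then have "one_of_three B x y z" "x \<in> {p..q}" "y \<in> {p..q}" "z \<in> {p..q}"
        using P by (auto simp: proper_def chords_iff)
      then show "one_of_three (B \<inter> {p..q}) x y z"
        by (simp add: one_of_three_def)
    qed
    moreover have "one_of_three B a m c"
      using P am mc ac unfolding proper_def by blast
    ultimately show "one_of_three B a m c \<and>
           proper (U \<inter> chords a m) (B \<inter> {a..m}) \<and> proper (U \<inter> chords m c) (B \<inter> {m..c})"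
      by blast
  next
    assume P: "one_of_three B a m c \<and>
           proper (U \<inter> chords a m) (B \<inter> {a..m}) \<and> proper (U \<inter> chords m c) (B \<inter> {m..c})"
    show "proper U B"
      unfolding proper_def
    proof (intro allI impI)
      fix x y z
      assume xyz: "(x, y) \<in> U" "(y, z) \<in> U" "(x, z) \<in> U"
      \<comment> \<open>The longest side decides: if it lies on one side of the cut, so do the other
        two; if it is the outer chord, uniqueness of the apex gives \<open>y = m\<close>.\<close>
      have "(x, z) = (a, c) \<or> (x, z) \<in> chords a m \<or> (x, z) \<in> chords m c"
        using full_triangulation_split[OF U am mc] xyz(3) by blast
      then consider "x = a" "z = c" | "(x, z) \<in> chords a m" | "(x, z) \<in> chords m c"
        by auto
      then show "one_of_three B x y z"
      proof cases
        case 1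
        then have "y = m"
          using full_triangulation_apex_unique[OF U am mc] xyz by auto
        then show ?thesis using P 1 by simp
      next
        case 2
        then have "(x, y) \<in> chords a m" "(y, z) \<in> chords a m"
          using r(2)[OF xyz(1)] r(2)[OF xyz(2)] by (auto simp: chords_iff)
        then have "one_of_three (B \<inter> {a..m}) x y z"
          using P xyz 2 unfolding proper_def by blast
        then show ?thesis
          using \<open>(x, y) \<in> chords a m\<close> \<open>(y, z) \<in> chords a m\<close>
          by (auto simp: one_of_three_def chords_iff)
      next
        case 3
        then have "(x, y) \<in> chords m c" "(y, z) \<in> chords m c"
          using r(2)[OF xyz(1)] r(2)[OF xyz(2)] by (auto simp: chords_iff)
        then have "one_of_three (B \<inter> {m..c}) x y z"
          using P xyz 3 unfolding proper_def by blast
        then show ?thesis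
          using \<open>(x, y) \<in> chords m c\<close> \<open>(y, z) \<in> chords m c\<close>
          by (auto simp: one_of_three_def chords_iff)
      qed
    qed
  }
qed

lemma nested_pair_cases:
  obtains m U1 B1 U2 B2 where "p = (m, (U1, B1), (U2, B2))"
  by (metis prod.exhaust)

text \<open>With at most one black end, the apex must be black exactly when both ends are white. So
  \<open>\<mu>\<close> depends only on the marked edge, and neither half gets two black ends. Both
  halves contain \<open>m\<close> and agree on its colour, which allows their colourings to be
  united.\<close>

lemma coloured_glue_bij:
  assumes ac: "Suc a < c" and \<mu>: "\<mu> = (\<not> \<alpha> \<and> \<not> \<gamma>)" and ends: "\<not> (\<alpha> \<and> \<gamma>)"
  shows "bij_betw (\<lambda>(m, (U1, B1), (U2, B2)). (insert (a, c) (U1 \<union> U2), B1 \<union> B2))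
           (SIGMA m:{a<..<c}. coloured \<alpha> \<mu> a m \<times> coloured \<mu> \<gamma> m c) (coloured \<alpha> \<gamma> a c)"
    (is "bij_betw ?f ?S ?Q")
proof (rule bij_betwI')
  \<comment> \<open>The pieces are recovered by restricting the glued pair. This gives membership in
    the target and, with uniqueness of the apex, injectivity.\<close>
  have key: "U1 = U \<inter> chords a m \<and> U2 = U \<inter> chords m c \<and> B1 = B \<inter> {a..m} \<and> B2 = B \<inter> {m..c} \<and>
       (a, m) \<in> U \<and> (m, c) \<in> U \<and> U \<in> full_triangulations a c \<and> (U, B) \<in> ?Q"
    if h: "a < m" "m < c" "(U1, B1) \<in> coloured \<alpha> \<mu> a m" "(U2, B2) \<in> coloured \<mu> \<gamma> m c"
      "U = insert (a, c) (U1 \<union> U2)" "B = B1 \<union> B2" for m U1 B1 U2 B2 U B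
  proof -
    have U1: "U1 \<in> full_triangulations a m" and U2: "U2 \<in> full_triangulations m c"
      using h by (auto simp: coloured_def)
    have B: "B1 \<subseteq> {a..m}" "B2 \<subseteq> {m..c}" "m \<in> B1 \<longleftrightarrow> \<mu>" "m \<in> B2 \<longleftrightarrow> \<mu>" "a \<in> B1 \<longleftrightarrow> \<alpha>" "c \<in> B2 \<longleftrightarrow> \<gamma>"
      and P: "proper U1 B1" "proper U2 B2"
      using h by (auto simp: coloured_def)
    have U: "U \<in> full_triangulations a c"
      unfolding h by (rule full_triangulation_glue[OF U1 U2 h(1,2)])
    have am: "(a, m) \<in> U" "(m, c) \<in> U"
      unfolding h using full_triangulation_base[OF U1 h(1)] full_triangulation_base[OF U2 h(2)] by auto
    have e1: "U1 = U \<inter> chords a m" "U2 = U \<inter> chords m c"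
      unfolding h(5) using full_triangulation_subset[OF U1] full_triangulation_subset[OF U2] h(1,2)
      by (auto simp: chords_def)
    have e2: "B1 = B \<inter> {a..m}"
    proof
      show "B1 \<subseteq> B \<inter> {a..m}" using B h by auto
      show "B \<inter> {a..m} \<subseteq> B1"
      proof
        fix x assume x: "x \<in> B \<inter> {a..m}"
        \<comment> \<open>The pieces overlap only in \<open>m\<close>, where both colourings
          agree.\<close>
        show "x \<in> B1"
        proof (cases "x \<in> B2")
          case True
          then have "x = m" using x B(2) by auto
          then show ?thesis using True B by simp
        qed (use x h in auto)
      qed
    qed
    have e3: "B2 = B \<inter> {m..c}"
    proof
      show "B2 \<subseteq> B \<inter> {m..c}" using B h by auto
      show "B \<inter> {m..c} \<subseteq> B2"
      proof
        fix x assume x: "x \<in> B \<inter> {m..c}"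
        show "x \<in> B2"
        proof (cases "x \<in> B1")
          case True
          then have "x = m" using x B(1) by auto
          then show ?thesis using True B by simp
        qed (use x h in auto)
      qed
    qed
    have mem: "a \<in> B \<longleftrightarrow> \<alpha>" "c \<in> B \<longleftrightarrow> \<gamma>" "m \<in> B \<longleftrightarrow> \<mu>"
      using B h(1,2) e2 e3 by auto
    have "one_of_three B a m c"
      unfolding one_of_three_def mem using \<mu> ends by auto
    then have "proper U B"
      unfolding proper_split[OF U am] using P e1 e2 e3 by simp
    moreover have "B \<subseteq> {a..c}"
      unfolding h(6) using B(1,2) h(1,2) by fastforce
    ultimately have "(U, B) \<in> ?Q"
      unfolding coloured_def using U mem by simp
    then show ?thesis by (intro conjI e1 e2 e3 am U)
  qed
  show "(?f p = ?f q) = (p = q)" if pq: "p \<in> ?S" "q \<in> ?S" for p q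
  proof
    assume eq: "?f p = ?f q"
    obtain m U1 B1 U2 B2 where p: "p = (m, (U1, B1), (U2, B2))" by (rule nested_pair_cases)
    obtain k V1 C1 V2 C2 where q: "q = (k, (V1, C1), (V2, C2))" by (rule nested_pair_cases)
    define U B where "U = insert (a, c) (U1 \<union> U2)" and "B = B1 \<union> B2"
    have UV: "U = insert (a, c) (V1 \<union> V2)" "B = C1 \<union> C2"
      using eq unfolding p q U_def B_def by auto
    have 1: "U1 = U \<inter> chords a m \<and> U2 = U \<inter> chords m c \<and> B1 = B \<inter> {a..m} \<and> B2 = B \<inter> {m..c} \<and>
       (a, m) \<in> U \<and> (m, c) \<in> U \<and> U \<in> full_triangulations a c \<and> (U, B) \<in> ?Q"
      by (rule key) (use pq p in \<open>auto simp: U_def B_def\<close>)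
    have 2: "V1 = U \<inter> chords a k \<and> V2 = U \<inter> chords k c \<and> C1 = B \<inter> {a..k} \<and> C2 = B \<inter> {k..c} \<and>
       (a, k) \<in> U \<and> (k, c) \<in> U \<and> U \<in> full_triangulations a c \<and> (U, B) \<in> ?Q"
      by (rule key) (use pq q UV in auto)
    have "m = k"
      using full_triangulation_apex_unique[of U a c m k] 1 2 by blast
    then show "p = q" using 1 2 p q by simp
  qed simp
  show "?f p \<in> ?Q" if "p \<in> ?S" for p
  proof -
    obtain m U1 B1 U2 B2 where p: "p = (m, (U1, B1), (U2, B2))" by (rule nested_pair_cases)
    show ?thesis using key[of m U1 B1 U2 B2] that unfolding p by auto
  qed
  show "\<exists>p\<in>?S. q = ?f p" if q: "q \<in> ?Q" for q
  proof -
    obtain U B where UB: "q = (U, B)" by force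
    have U: "U \<in> full_triangulations a c" and B: "B \<subseteq> {a..c}" "a \<in> B \<longleftrightarrow> \<alpha>" "c \<in> B \<longleftrightarrow> \<gamma>"
      and P: "proper U B"
      using q by (auto simp: UB coloured_def)
    obtain m where m: "a < m" "m < c" and am: "(a, m) \<in> U" "(m, c) \<in> U"
      using full_triangulation_apex[OF U ac] by blast
    have P': "one_of_three B a m c" "proper (U \<inter> chords a m) (B \<inter> {a..m})"
        "proper (U \<inter> chords m c) (B \<inter> {m..c})"
      using P unfolding proper_split[OF U am] by auto
    have "m \<in> B \<longleftrightarrow> \<mu>"
      using P'(1) B ends unfolding \<mu> one_of_three_def by auto
    then have "(U \<inter> chords a m, B \<inter> {a..m}) \<in> coloured \<alpha> \<mu> a m"
        "(U \<inter> chords m c, B \<inter> {m..c}) \<in> coloured \<mu> \<gamma> m c"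
      using P' full_triangulation_restrict[OF U am(1)] full_triangulation_restrict[OF U am(2)] B m
      by (auto simp: coloured_def)
    then have "(m, (U \<inter> chords a m, B \<inter> {a..m}), (U \<inter> chords m c, B \<inter> {m..c})) \<in> ?S" (is "?p \<in> _")
      using m by simp
    moreover have "B \<inter> {a..m} \<union> B \<inter> {m..c} = B" using B(1) m by auto
    then have "q = ?f ?p"
      by (simp add: UB flip: full_triangulation_split[OF U am])
    ultimately show ?thesis by blast
  qed
qed

lemma coloured_Suc:
  "coloured \<alpha> \<gamma> a (Suc a) = {({(a, Suc a)}, {x. x = a \<and> \<alpha> \<or> x = Suc a \<and> \<gamma>})}"
proof -
  have "{a..Suc a} = {a, Suc a}" by auto
  moreover have "proper {(a, Suc a)} B" for B by (simp add: proper_def)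
  moreover have "B \<subseteq> {a, Suc a} \<and> (a \<in> B) = \<alpha> \<and> (Suc a \<in> B) = \<gamma> \<longleftrightarrow>
      B = {x. x = a \<and> \<alpha> \<or> x = Suc a \<and> \<gamma>}" for B
    by auto
  ultimately show ?thesis
    unfolding coloured_def full_triangulations_Suc by (auto simp del: Collect_disj_eq)
qed

text \<open>Induction on the length of the interval: the outer triangle forces the colour of the
  apex, hence the end colours of both halves, to which the induction hypothesis applies.\<close>

lemma coloured_unique:
  assumes "U \<in> full_triangulations a c" "a < c" "\<not> (\<alpha> \<and> \<gamma>)"
  shows "\<exists>!B. (U, B) \<in> coloured \<alpha> \<gamma> a c"
  using assms
proof (induction "c - a" arbitrary: U a c \<alpha> \<gamma> rule: less_induct)
  case less
  note U = less.prems(1) and ends = less.prems(3)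
  show ?case
  proof (cases "c = Suc a")
    case True
    then show ?thesis
      using U by (simp add: coloured_Suc full_triangulations_Suc)
  next
    case False
    then have ac: "Suc a < c" using less.prems by simp
    define \<mu> where "\<mu> = (\<not> \<alpha> \<and> \<not> \<gamma>)"
    note bij = coloured_glue_bij[OF ac \<mu>_def ends]
    let ?f = "\<lambda>(m, (U1, B1), (U2, B2)). (insert (a, c) (U1 \<union> U2), B1 \<union> B2)"
    let ?S = "SIGMA m:{a<..<c}. coloured \<alpha> \<mu> a m \<times> coloured \<mu> \<gamma> m c"
    obtain m where m: "a < m" "m < c" and am: "(a, m) \<in> U" "(m, c) \<in> U"
      using full_triangulation_apex[OF U ac] by blast
    note R1 = full_triangulation_restrict[OF U am(1)]
    note R2 = full_triangulation_restrict[OF U am(2)]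
    have ex1: "\<exists>!B. (U \<inter> chords a m, B) \<in> coloured \<alpha> \<mu> a m"
      by (rule less.hyps[OF _ R1]) (use m ends in \<open>auto simp: \<mu>_def\<close>)
    have ex2: "\<exists>!B. (U \<inter> chords m c, B) \<in> coloured \<mu> \<gamma> m c"
      by (rule less.hyps[OF _ R2]) (use m ends in \<open>auto simp: \<mu>_def\<close>)
    obtain B1 where B1: "(U \<inter> chords a m, B1) \<in> coloured \<alpha> \<mu> a m"
        "\<And>B. (U \<inter> chords a m, B) \<in> coloured \<alpha> \<mu> a m \<Longrightarrow> B = B1"
      using ex1 by (elim ex1E) blast
    obtain B2 where B2: "(U \<inter> chords m c, B2) \<in> coloured \<mu> \<gamma> m c"
        "\<And>B. (U \<inter> chords m c, B) \<in> coloured \<mu> \<gamma> m c \<Longrightarrow> B = B2"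
      using ex2 by (elim ex1E) blast
    have "(U, B1 \<union> B2) \<in> coloured \<alpha> \<gamma> a c"
    proof -
      have "(m, (U \<inter> chords a m, B1), (U \<inter> chords m c, B2)) \<in> ?S"
        using B1(1) B2(1) m by simp
      from bij_betwE[OF bij, rule_format, OF this] show ?thesis
        by (simp flip: full_triangulation_split[OF U am])
    qed
    moreover have "B = B1 \<union> B2" if "(U, B) \<in> coloured \<alpha> \<gamma> a c" for B
    proof -
      have P: "one_of_three B a m c" "proper (U \<inter> chords a m) (B \<inter> {a..m})"
        "proper (U \<inter> chords m c) (B \<inter> {m..c})" and B: "B \<subseteq> {a..c}" "a \<in> B \<longleftrightarrow> \<alpha>" "c \<in> B \<longleftrightarrow> \<gamma>"
        using that proper_split[OF U am, of B] by (auto simp: coloured_def)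
      have "m \<in> B \<longleftrightarrow> \<mu>"
        using P(1) B ends unfolding \<mu>_def one_of_three_def by auto
      then have "(U \<inter> chords a m, B \<inter> {a..m}) \<in> coloured \<alpha> \<mu> a m"
          "(U \<inter> chords m c, B \<inter> {m..c}) \<in> coloured \<mu> \<gamma> m c"
        using P B R1 R2 m by (auto simp: coloured_def)
      then have "B \<inter> {a..m} = B1" "B \<inter> {m..c} = B2"
        using B1(2) B2(2) by simp_all
      moreover have "B = B \<inter> {a..m} \<union> B \<inter> {m..c}" using B(1) m by auto
      ultimately show ?thesis by simp
    qed
    ultimately show ?thesis by blast
  qed
qed

section \<open>Generating functions\<close>

text \<open>The open interval leaves out the ends, so gluing adds only the apex to the black
  vertices already counted. The exponent belongs to the variable x of the overview.\<close>

definition weight :: "bool \<Rightarrow> bool \<Rightarrow> nat \<Rightarrow> nat \<Rightarrow> real fps" where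
  "weight \<alpha> \<gamma> a c = (\<Sum>(U, B)\<in>coloured \<alpha> \<gamma> a c. fps_X ^ card (B \<inter> {a<..<c}))"

lemma finite_coloured: "finite (coloured \<alpha> \<gamma> a c)"
  by (rule finite_subset[of _ "full_triangulations a c \<times> Pow {a..c}"])
     (auto simp: coloured_def finite_full_triangulations)

lemma weight_Suc:
  "weight \<alpha> \<gamma> a (Suc a) = 1"
proof -
  have "{a<..<Suc a} = {}" by auto
  then show ?thesis by (simp add: weight_def coloured_Suc)
qed

lemma weight_rec:
  assumes ac: "Suc a < c" and \<mu>: "\<mu> = (\<not> \<alpha> \<and> \<not> \<gamma>)" and ends: "\<not> (\<alpha> \<and> \<gamma>)"
  shows "weight \<alpha> \<gamma> a c = (\<Sum>m\<in>{a<..<c}. fps_X ^ of_bool \<mu> * weight \<alpha> \<mu> a m * weight \<mu> \<gamma> m c)"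
proof -
  let ?S = "SIGMA m:{a<..<c}. coloured \<alpha> \<mu> a m \<times> coloured \<mu> \<gamma> m c"
  let ?g = "\<lambda>(m, (U1, B1), (U2, B2)). fps_X ^ of_bool \<mu> * fps_X ^ card (B1 \<inter> {a<..<m}) * fps_X ^ card (B2 \<inter> {m<..<c})
       :: real fps"
  let ?f = "\<lambda>(m, (U1, B1), (U2, B2)). (insert (a, c) (U1 \<union> U2), B1 \<union> B2)"
  let ?h = "\<lambda>(U, B). fps_X ^ card (B \<inter> {a<..<c}) :: real fps"
  have "weight \<alpha> \<gamma> a c = (\<Sum>p\<in>?S. ?h (?f p))"
    unfolding weight_def
    by (rule sum.reindex_bij_betw[OF coloured_glue_bij[OF ac \<mu> ends], symmetric])
  also have "\<dots> = (\<Sum>p\<in>?S. ?g p)"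
  proof (rule sum.cong[OF refl])
    fix p assume p: "p \<in> ?S"
    obtain m U1 B1 U2 B2 where pe: "p = (m, (U1, B1), (U2, B2))" by (rule nested_pair_cases)
    have m: "a < m" "m < c" and B: "B1 \<subseteq> {a..m}" "B2 \<subseteq> {m..c}" "m \<in> B1 \<longleftrightarrow> \<mu>" "m \<in> B2 \<longleftrightarrow> \<mu>"
      using p by (auto simp: pe coloured_def)
    \<comment> \<open>The apex is interior to the whole interval but an end of both pieces; hence
      the separate factor \<open>fps_X ^ of_bool \<mu>\<close>.\<close>
    have "(B1 \<union> B2) \<inter> {a<..<c} = (B1 \<inter> {a<..<m}) \<union> (B2 \<inter> {m<..<c}) \<union> (if \<mu> then {m} else {})"
      using m B by (force simp: subset_iff less_le)
    also have "card \<dots> = card (B1 \<inter> {a<..<m}) + card (B2 \<inter> {m<..<c}) + of_bool \<mu>"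
    proof -
      have "(B1 \<inter> {a<..<m}) \<inter> (B2 \<inter> {m<..<c}) = {}"
        "((B1 \<inter> {a<..<m}) \<union> (B2 \<inter> {m<..<c})) \<inter> (if \<mu> then {m} else {}) = {}" by auto
      then show ?thesis by (simp add: card_Un_disjoint)
    qed
    finally show "?h (?f p) = ?g p"
      by (simp add: pe power_add mult_ac)
  qed
  also have "\<dots> = (\<Sum>m\<in>{a<..<c}. \<Sum>q\<in>coloured \<alpha> \<mu> a m \<times> coloured \<mu> \<gamma> m c. ?g (m, q))"
    by (subst sum.Sigma) (auto simp: finite_coloured)
  also have "\<dots> = (\<Sum>m\<in>{a<..<c}. fps_X ^ of_bool \<mu> * weight \<alpha> \<mu> a m * weight \<mu> \<gamma> m c)"
  proof (rule sum.cong[OF refl])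
    fix m
    show "(\<Sum>q\<in>coloured \<alpha> \<mu> a m \<times> coloured \<mu> \<gamma> m c. ?g (m, q)) =
        fps_X ^ of_bool \<mu> * weight \<alpha> \<mu> a m * weight \<mu> \<gamma> m c"
      unfolding weight_def mult.assoc sum_product sum.cartesian_product
      by (simp add: sum_distrib_left case_prod_unfold mult_ac)
  qed
  finally show ?thesis .
qed

text \<open>The recursion and its value on a single edge involve only the length of the
  interval.\<close>

lemma weight_shift:
  assumes "a < c" "\<not> (\<alpha> \<and> \<gamma>)"
  shows "weight \<alpha> \<gamma> (a + k) (c + k) = weight \<alpha> \<gamma> a c"
  using assms
proof (induction "c - a" arbitrary: a c \<alpha> \<gamma> rule: less_induct)
  case less
  show ?case
  proof (cases "c = Suc a")
    case True
    then show ?thesis using weight_Suc less.prems by simp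
  next
    case False
    then have ac: "Suc a < c" "Suc (a + k) < c + k" using less.prems by auto
    define \<mu> where "\<mu> = (\<not> \<alpha> \<and> \<not> \<gamma>)"
    have "weight \<alpha> \<gamma> (a + k) (c + k) =
       (\<Sum>m\<in>{a<..<c}. fps_X ^ of_bool \<mu> * weight \<alpha> \<mu> (a + k) (m + k) * weight \<mu> \<gamma> (m + k) (c + k))"
      unfolding weight_rec[OF ac(2) \<mu>_def less.prems(2)]
      by (rule sum.reindex_bij_witness[of _ "\<lambda>m. m + k" "\<lambda>m. m - k"]) auto
    also have "\<dots> = (\<Sum>m\<in>{a<..<c}. fps_X ^ of_bool \<mu> * weight \<alpha> \<mu> a m * weight \<mu> \<gamma> m c)"
    proof (rule sum.cong[OF refl])
      fix m assume "m \<in> {a<..<c}"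
      then have "weight \<alpha> \<mu> (a + k) (m + k) = weight \<alpha> \<mu> a m" "weight \<mu> \<gamma> (m + k) (c + k) = weight \<mu> \<gamma> m c"
        using less.prems(2) by (auto simp: \<mu>_def intro!: less.hyps)
      then show "fps_X ^ of_bool \<mu> * weight \<alpha> \<mu> (a + k) (m + k) * weight \<mu> \<gamma> (m + k) (c + k) =
          fps_X ^ of_bool \<mu> * weight \<alpha> \<mu> a m * weight \<mu> \<gamma> m c" by simp
    qed
    finally show ?thesis unfolding weight_rec[OF ac(1) \<mu>_def less.prems(2)] .
  qed
qed

section \<open>Functional equations\<close>

text \<open>The \<open>N\<close>-th coefficient belongs to the polygon with \<open>N + 2\<close> vertices.\<close>

definition gen :: "bool \<Rightarrow> bool \<Rightarrow> real fps fps" where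
  "gen \<alpha> \<gamma> = Abs_fps (\<lambda>N. weight \<alpha> \<gamma> 0 (Suc N))"

text \<open>The outer \<open>fps_X\<close> is z and \<open>fps_const fps_X\<close> is x. The
  constant 1 is the degenerate polygon. An apex \<open>m\<close> leaves pieces with indices
  \<open>m - 1\<close> and \<open>N - m\<close>, whose sum falls one short of \<open>N\<close>;
  hence the factor z.\<close>

lemma gen_rec:
  assumes ends: "\<not> (\<alpha> \<and> \<gamma>)" and \<mu>: "\<mu> = (\<not> \<alpha> \<and> \<not> \<gamma>)"
  shows "gen \<alpha> \<gamma> = 1 + fps_X * fps_const (fps_X ^ of_bool \<mu>) * gen \<alpha> \<mu> * gen \<mu> \<gamma>"
proof (rule fps_ext)
  fix N
  show "gen \<alpha> \<gamma> $ N = (1 + fps_X * fps_const (fps_X ^ of_bool \<mu>) * gen \<alpha> \<mu> * gen \<mu> \<gamma>) $ N"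
  proof (cases N)
    case 0
    then show ?thesis using weight_Suc[of \<alpha> \<gamma> 0] by (simp add: gen_def mult.assoc)
  next
    case (Suc M)
    have "gen \<alpha> \<gamma> $ N = (\<Sum>m\<in>{0<..<Suc N}. fps_X ^ of_bool \<mu> * weight \<alpha> \<mu> 0 m * weight \<mu> \<gamma> m (Suc N))"
      unfolding gen_def fps_nth_Abs_fps by (rule weight_rec[OF _ \<mu> ends]) (simp add: Suc)
    also have "\<dots> = (\<Sum>i=0..M. fps_X ^ of_bool \<mu> * weight \<alpha> \<mu> 0 (Suc i) * weight \<mu> \<gamma> (Suc i) (Suc N))"
      by (rule sum.reindex_bij_witness[of _ Suc "\<lambda>m. m - 1"]) (auto simp: Suc)
    also have "\<dots> = (\<Sum>i=0..M. fps_X ^ of_bool \<mu> * weight \<alpha> \<mu> 0 (Suc i) * weight \<mu> \<gamma> 0 (Suc (M - i)))"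
    proof (rule sum.cong[OF refl])
      fix i assume i: "i \<in> {0..M}"
      \<comment> \<open>The right piece, from \<open>Suc i\<close> to \<open>Suc N\<close>, is moved
        down to start at \<open>0\<close>.\<close>
      have "weight \<mu> \<gamma> (0 + Suc i) (Suc (M - i) + Suc i) = weight \<mu> \<gamma> 0 (Suc (M - i))"
        by (rule weight_shift) (use \<mu> in auto)
      then show "fps_X ^ of_bool \<mu> * weight \<alpha> \<mu> 0 (Suc i) * weight \<mu> \<gamma> (Suc i) (Suc N) =
          fps_X ^ of_bool \<mu> * weight \<alpha> \<mu> 0 (Suc i) * weight \<mu> \<gamma> 0 (Suc (M - i))"
        using i by (simp add: Suc)
    qed
    also have "\<dots> = fps_X ^ of_bool \<mu> * (gen \<alpha> \<mu> * gen \<mu> \<gamma>) $ M"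
      by (simp only: fps_mult_nth gen_def fps_nth_Abs_fps sum_distrib_left mult.assoc)
    also have "\<dots> = (1 + fps_X * (fps_const (fps_X ^ of_bool \<mu>) * (gen \<alpha> \<mu> * gen \<mu> \<gamma>))) $ N"
      by (simp only: Suc fps_add_nth fps_X_mult_nth fps_mult_left_const_nth fps_one_nth) simp
    also have "fps_X * (fps_const (fps_X ^ of_bool \<mu>) * (gen \<alpha> \<mu> * gen \<mu> \<gamma>)) =
        fps_X * fps_const (fps_X ^ of_bool \<mu>) * gen \<alpha> \<mu> * gen \<mu> \<gamma>"
      by (simp only: mult.assoc)
    finally show ?thesis .
  qed
qed

text \<open>Both series are inverse to \<open>1 - fps_X * gen False False\<close>: the half with one
  black end lies left of the apex in one case and right of it in the other, and multiplication
  commutes.\<close>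

lemma gen_reverse: "gen True False = gen False True"
proof -
  let ?A = "gen False False"
  have 1: "gen False True * (1 - fps_X * ?A) = 1"
    using gen_rec[of False True False] by (simp add: algebra_simps)
  have 2: "gen True False * (1 - fps_X * ?A) = 1"
    using gen_rec[of True False False] by (simp add: algebra_simps)
  have "gen True False * (gen False True * (1 - fps_X * ?A)) =
      gen False True * (gen True False * (1 - fps_X * ?A))"
    by (simp only: mult.left_commute)
  then show ?thesis unfolding 1 2 by simp
qed

lemma gen_white_white:
  "gen False False = 1 + fps_X * fps_const fps_X * gen False True ^ 2"
  using gen_rec[of False False True] by (simp add: gen_reverse power2_eq_square mult.assoc)

lemma gen_power_rec:
  "gen False True ^ Suc r = gen False True ^ r + fps_X * gen False True ^ Suc r +
     fps_X * (fps_X * (fps_const fps_X * gen False True ^ (r + 3)))"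
proof -
  let ?D = "gen False True"
  have "?D = 1 + fps_X * (1 + fps_X * fps_const fps_X * ?D ^ 2) * ?D"
    using gen_rec[of False True False] by (simp flip: gen_white_white)
  then have "?D ^ r * ?D = ?D ^ r * (1 + fps_X * (1 + fps_X * fps_const fps_X * ?D ^ 2) * ?D)"
    by simp
  then show ?thesis
    by (simp add: algebra_simps power_add power2_eq_square power3_eq_cube)
qed

section \<open>Closed form for the coefficients of the powers\<close>

text \<open>Lagrange inversion gives this as the coefficient of \<open>x\<^sup>j y\<^sup>k\<close> in \<open>D\<^sup>r\<close> when \<open>y\<close> marks the white
  vertices off the marked edge and \<open>x\<close> the black ones.\<close>

definition lagrange_coeff :: "nat \<Rightarrow> nat \<Rightarrow> nat \<Rightarrow> real" where
  "lagrange_coeff r k j =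
     (if k = 0 then of_bool (j = 0)
      else real r / real k * real (k choose j) * real ((k + 2 * j + r - 1) choose (k - 1)))"

text \<open>Passing from \<open>Suc r\<close> to \<open>r + 3\<close> while lowering
  \<open>j\<close> by one keeps the upper index \<open>N\<close>. After Pascal's rule every term is
  a rational multiple of \<open>P\<close> times \<open>Q\<close>, and a polynomial identity remains.
  The case \<open>k = 0\<close> is separate because the closed form divides by
  \<open>k\<close>.\<close>

lemma lagrange_coeff_rec:
  "lagrange_coeff (Suc r) (Suc k) j = lagrange_coeff r (Suc k) j + lagrange_coeff (Suc r) k j +
     (if j = 0 then 0 else lagrange_coeff (r + 3) k (j - 1))"
proof (cases k)
  case 0
  then show ?thesis
    by (cases j) (auto simp: lagrange_coeff_def field_simps)
next
  case (Suc l)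
  define N where "N = k + 2 * j + r"
  define P where "P = real (N choose l)"
  define Q where "Q = real (Suc k choose j)"
  have kl: "real k = real l + 1" "0 < real k" using Suc by auto
  have N: "real N = real k + 2 * real j + real r" by (simp add: N_def)
  have "Suc l * (N choose Suc l) = (N - l) * (N choose l)"
    using binomial_absorb_comp[of N l] by (metis binomial_absorption mult.commute)
  then have "real (Suc l) * real (N choose Suc l) = real (N - l) * P"
    unfolding P_def by (metis of_nat_mult)
  then have 1: "real k * real (N choose k) = (real N - real k + 1) * P"
    using Suc N_def by (simp add: of_nat_diff)
  have 2: "real (Suc N choose k) = real (N choose k) + P"
    by (simp add: Suc P_def)
  have "(Suc k - j) * (Suc k choose j) = Suc k * (k choose j)"
    using binomial_absorb_comp[of "Suc k" j] by simp
  then have "real (Suc k - j) * Q = real (Suc k) * real (k choose j)"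
    unfolding Q_def by (metis of_nat_mult)
  \<comment> \<open>For \<open>j > Suc k\<close> the natural difference is truncated, but then
    \<open>Q\<close> is 0.\<close>
  moreover have "real (Suc k - j) * Q = (real k + 1 - real j) * Q"
    by (cases "j \<le> Suc k") (auto simp: Q_def of_nat_diff)
  ultimately have 3: "real (k choose j) = (real k + 1 - real j) * Q / (real k + 1)"
    by (simp add: field_simps)
  have 4: "real (k choose (j - 1)) = real j * Q / (real k + 1)" if "j \<noteq> 0"
  proof -
    obtain i where i: "j = Suc i" using \<open>j \<noteq> 0\<close> by (cases j) auto
    have "real (Suc i * (Suc k choose Suc i)) = real (Suc k * (k choose i))"
      by (simp only: Suc_times_binomial)
    then show ?thesis by (simp add: i Q_def field_simps)
  qed
  have L: "lagrange_coeff (Suc r) (Suc k) j = (real r + 1) / (real k + 1) * Q * (real (N choose k) + P)"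
    using 2 by (simp add: lagrange_coeff_def N_def Q_def add.commute)
  have R1: "lagrange_coeff r (Suc k) j = real r / (real k + 1) * Q * real (N choose k)"
    by (simp add: lagrange_coeff_def N_def Q_def add.commute)
  have R2: "lagrange_coeff (Suc r) k j = (real r + 1) / real k * real (k choose j) * P"
    by (simp add: lagrange_coeff_def N_def P_def Suc add.commute)
  have R3: "(if j = 0 then 0 else lagrange_coeff (r + 3) k (j - 1)) =
      (real r + 3) / real k * (real j * Q / (real k + 1)) * P"
  proof (cases "j = 0")
    case False
    then have "k + 2 * (j - 1) + (r + 3) - 1 = N" by (simp add: N_def)
    then show ?thesis
      using False 4[OF False] by (simp add: lagrange_coeff_def P_def Suc)
  qed simp
  have 5: "real (N choose k) = (2 * real j + real r + 1) * P / real k"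
    using 1 kl N by (simp add: field_simps)
  show ?thesis
    unfolding L R1 R2 R3 3 5 using kl(2) by (simp add: divide_simps) algebra
qed

text \<open>The outer induction covers all \<open>r\<close> at smaller \<open>N\<close>; the inner
  one is for the term with \<open>D^r\<close>, the only one that stays at \<open>N\<close>. As z
  counts all vertices off the marked edge, \<open>N - j\<close> of them are white.\<close>

lemma gen_power_nth:
  "gen False True ^ r $ N $ j = (if j \<le> N then lagrange_coeff r (N - j) j else 0)"
proof (induction N arbitrary: r j rule: less_induct)
  case (less N)
  show ?case
  proof (cases N)
    case 0
    have "gen False True $ 0 = 1"
      using weight_Suc[of False True 0] by (simp add: gen_def)
    then show ?thesis
      by (simp add: 0 fps_power_zeroth lagrange_coeff_def)
  next
    case (Suc M)
    show ?thesis
    proof (induction r)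
      case 0
      then show ?case by (simp add: Suc lagrange_coeff_def)
    next
      case (Suc r)
      have "gen False True ^ Suc r $ N = gen False True ^ r $ N + gen False True ^ Suc r $ M +
          (if M = 0 then 0 else fps_X * gen False True ^ (r + 3) $ (M - 1))"
        by (subst gen_power_rec)
           (simp add: \<open>N = Suc M\<close> fps_X_mult_nth del: power_Suc)
      then have "gen False True ^ Suc r $ N $ j = gen False True ^ r $ N $ j + gen False True ^ Suc r $ M $ j +
          (if M = 0 \<or> j = 0 then 0 else gen False True ^ (r + 3) $ (M - 1) $ (j - 1))"
        by (simp add: fps_X_mult_nth del: power_Suc)
      also have "\<dots> = (if j \<le> N then lagrange_coeff r (N - j) j else 0) +
          (if j \<le> M then lagrange_coeff (Suc r) (M - j) j else 0) +
          (if j = 0 \<or> M < j then 0 else lagrange_coeff (r + 3) (M - j) (j - 1))"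
        using less[of M "Suc r" j] less[of "M - 1" "r + 3" "j - 1"] Suc \<open>N = Suc M\<close>
        by (auto simp del: power_Suc)
      \<comment> \<open>For \<open>j = N\<close> the closed form is evaluated at
        \<open>k = 0\<close>, where it is the same for every \<open>r\<close>; for
        \<open>j < N\<close> the recursion applies with \<open>k = M - j\<close>.\<close>
      also have "\<dots> = (if j \<le> N then lagrange_coeff (Suc r) (N - j) j else 0)"
        using lagrange_coeff_rec[of r "M - j" j] \<open>N = Suc M\<close>
        by (auto simp: Suc_diff_le lagrange_coeff_def[of _ 0] le_Suc_eq)
      finally show ?case .
    qed
  qed
qed

section \<open>From coefficients to the stated formulas\<close>

lemma binom_of_nat: "0 \<le> m \<Longrightarrow> binom m (int k) = real (nat m choose k)"
  by (simp add: binom_def binomial_gbinomial)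

lemma binom_neg: "k < 0 \<Longrightarrow> binom m k = 0"
  by (simp add: binom_def)

text \<open>The black end of the marked edge is not counted by \<open>gen\<close>, so
  \<open>j = b - 1\<close> and \<open>k = w - 1\<close>. Absorption trades the factor
  \<open>1 / k\<close> of \<open>lagrange_coeff 1 k j\<close> for
  \<open>1 / (2 * j + k + 1)\<close>.\<close>

lemma gen_white_black_nth:
  assumes "b + w = n + 2" "2 * real b + real w - 2 \<noteq> 0"
  shows "(if b = 0 then 0 else gen False True $ n $ (b - 1)) =
    1 / (2 * real b + real w - 2) *
      binom (2 * int b + int w - 2) (int w - 1) * binom (int w - 1) (int b - 1)"
proof (cases "b = 0 \<or> w = 0")
  \<comment> \<open>A lower argument is negative, so \<open>binom\<close> is 0; for
    \<open>w = 0\<close> the coefficient is 0 because \<open>b - 1\<close> exceeds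
    \<open>n\<close>.\<close>
  case True
  then show ?thesis
    using assms gen_power_nth[of 1 n "b - 1"] by (auto simp: binom_neg)
next
  case False
  then obtain j k where b: "b = Suc j" and w: "w = Suc k" by (meson not0_implies_Suc)
  have n: "n = j + k" using assms b w by simp
  have e: "2 * int b + int w - 2 = int (2 * j + k + 1)" "int w - 1 = int k" "int b - 1 = int j"
    "2 * real b + real w - 2 = real (2 * j + k + 1)"
    by (simp_all add: b w)
  have "gen False True $ n $ (b - 1) = lagrange_coeff 1 k j"
    using gen_power_nth[of 1 n "b - 1"] by (simp add: n b)
  also have "\<dots> = 1 / real (2 * j + k + 1) * real ((2 * j + k + 1) choose k) * real (k choose j)"
  proof (cases k)
    case 0
    then show ?thesis by (simp add: lagrange_coeff_def)
  next
    case (Suc l)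
    have "real (Suc l * (Suc (2 * j + k) choose Suc l)) = real (Suc (2 * j + k) * ((2 * j + k) choose l))"
      by (simp only: Suc_times_binomial)
    then have 1: "real (2 * j + k + 1 choose k) =
        real (2 * j + k + 1) * real (2 * j + k choose l) / real k"
      by (simp add: Suc field_simps del: binomial_Suc_Suc)
    have 2: "lagrange_coeff 1 k j = 1 / real k * real (k choose j) * real (2 * j + k choose l)"
      by (simp add: lagrange_coeff_def Suc add.commute)
    show ?thesis unfolding 1 2 using Suc by (simp add: divide_simps)
  qed
  finally show ?thesis
    unfolding e binom_of_nat[OF of_nat_0_le_iff] nat_int by (simp add: b)
qed

lemma gen_white_white_nth_power:
  "gen False False $ n $ b =
     (if n = 0 then of_bool (b = 0) else if b = 0 then 0 else gen False True ^ 2 $ (n - 1) $ (b - 1))"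
  unfolding gen_white_white by (simp add: fps_X_mult_nth mult.assoc)

text \<open>The apex is black and both ends are white, so \<open>j = b - 1\<close> and
  \<open>k = w - 2\<close>. Absorption in each of the two binomials turns
  \<open>lagrange_coeff 2 k j\<close> into the stated product.\<close>

lemma gen_white_white_nth:
  assumes "b + w = n + 2" "(real w - 1) * (2 * real b + real w - 2) \<noteq> 0"
  shows "gen False False $ n $ b =
    2 * real b / ((real w - 1) * (2 * real b + real w - 2)) *
      binom (2 * int b + int w - 2) (int w - 2) * binom (int w - 1) (int b)"
proof -
  note g = gen_white_white_nth_power
  \<comment> \<open>In the first three cases both sides are 0. For \<open>n = 0\<close> the
    hypothesis on the denominator leaves only \<open>b = 2\<close>; for \<open>w < 2\<close> a lower
    argument is negative and \<open>b - 1\<close> exceeds \<open>n - 1\<close>.\<close>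
  consider "n = 0" | "b = 0" "n > 0" | "n > 0" "b > 0" "w < 2" | "b > 0" "w \<ge> 2" by linarith
  then show ?thesis
  proof cases
    case 1
    then have "b = 0 \<or> b = 1 \<or> b = 2" using assms by linarith
    then show ?thesis using 1 assms unfolding g by (auto simp: binom_neg)
  next
    case 2
    then show ?thesis unfolding g by simp
  next
    case 3
    then have "\<not> b - 1 \<le> n - 1" using assms by linarith
    then show ?thesis using 3 by (simp add: g gen_power_nth binom_neg)
  next
    case 4
    obtain j where b: "b = Suc j" using 4 by (cases b) auto
    obtain k where w: "w = k + 2" using 4 by (metis add.commute le_Suc_ex)
    have n: "n = Suc (j + k)" using assms b w by simp
    have e: "2 * int b + int w - 2 = int (2 * j + k + 2)" "int w - 1 = int (Suc k)" "int w - 2 = int k"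
      "2 * real b + real w - 2 = real (2 * j + k + 2)" "real w - 1 = real (Suc k)"
      by (simp_all add: b w)
    have "gen False False $ n $ b = lagrange_coeff 2 k j"
      unfolding g by (simp add: n b gen_power_nth)
    also have "\<dots> = 2 * real (Suc j) / (real (Suc k) * real (2 * j + k + 2)) *
        real ((2 * j + k + 2) choose k) * real (Suc k choose Suc j)"
    proof -
      have "real (Suc j * (Suc k choose Suc j)) = real (Suc k * (k choose j))"
        by (simp only: Suc_times_binomial)
      then have 1: "real (Suc k choose Suc j) = real (Suc k) * real (k choose j) / real (Suc j)"
        by (simp add: field_simps)
      show ?thesis
      proof (cases k)
        case 0
        then show ?thesis by (cases j) (simp_all add: lagrange_coeff_def)
      next
        case (Suc l)
        have "real (Suc l * (Suc (2 * j + k + 1) choose Suc l)) =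
            real (Suc (2 * j + k + 1) * ((2 * j + k + 1) choose l))"
          by (simp only: Suc_times_binomial)
        then have 2: "real ((2 * j + k + 2) choose k) =
            real (2 * j + k + 2) * real ((2 * j + k + 1) choose l) / real k"
          by (simp add: Suc field_simps)
        have 3: "lagrange_coeff 2 k j = 2 / real k * real (k choose j) * real ((2 * j + k + 1) choose l)"
          by (simp add: lagrange_coeff_def Suc add.commute)
        show ?thesis unfolding 1 2 3 using Suc by (simp add: divide_simps)
      qed
    qed
    finally show ?thesis
      unfolding e binom_of_nat[OF of_nat_0_le_iff] nat_int by (simp only: b)
  qed
qed

section \<open>Triangulations as sets of diagonals\<close>

lemma crossing_iff_crosses:
  assumes "x < y" "u < v"
  shows "crossing {x, y} {u, v} \<longleftrightarrow> crosses (x, y) (u, v)"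
proof
  assume "crossing {x, y} {u, v}"
  then obtain i j k l where "i < j" "j < k" "k < l"
    "{x, y} = {i, k} \<and> {u, v} = {j, l} \<or> {x, y} = {j, l} \<and> {u, v} = {i, k}"
    unfolding crossing_def by blast
  then show "crosses (x, y) (u, v)"
    using assms by (auto simp: doubleton_eq_iff crosses_iff)
next
  assume "crosses (x, y) (u, v)"
  then show "crossing {x, y} {u, v}"
    unfolding crosses_iff crossing_def by blast
qed

lemma boundary_edges_iff:
  assumes "x < y"
  shows "{x, y} \<in> boundary_edges n \<longleftrightarrow> y = Suc x \<and> y \<le> Suc n \<or> x = 0 \<and> y = Suc n"
proof
  assume "{x, y} \<in> boundary_edges n"
  then obtain i where i: "i < n + 2" "{x, y} = {i, (i + 1) mod (n + 2)}"
    by (auto simp: boundary_edges_def)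
  then show "y = Suc x \<and> y \<le> Suc n \<or> x = 0 \<and> y = Suc n"
    \<comment> \<open>\<open>i = Suc n\<close> is the wrap-around edge, whose second endpoint is
      \<open>0\<close>.\<close>
    using assms by (cases "i = Suc n") (auto simp: doubleton_eq_iff)
next
  assume "y = Suc x \<and> y \<le> Suc n \<or> x = 0 \<and> y = Suc n"
  then show "{x, y} \<in> boundary_edges n"
  proof
    assume "y = Suc x \<and> y \<le> Suc n"
    then show ?thesis
      by (auto simp: boundary_edges_def intro!: exI[of _ x])
  next
    assume "x = 0 \<and> y = Suc n"
    then show ?thesis
      by (auto simp: boundary_edges_def intro!: exI[of _ "Suc n"])
  qed
qed

lemma vertex_pair_cases:
  assumes "d \<subseteq> vertices n" "card d = 2"
  obtains x y where "x < y" "y \<le> Suc n" "d = {x, y}"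
proof -
  obtain x y where d: "d = {x, y}" "x \<noteq> y" using assms(2) by (auto simp: card_2_iff)
  show ?thesis
  proof (cases "x < y")
    case True
    then show ?thesis using that[of x y] d assms(1) by (auto simp: vertices_def)
  next
    case False
    then show ?thesis using that[of y x] d assms(1) by (auto simp: vertices_def)
  qed
qed

lemma diagonals_iff:
  assumes "x < y"
  shows "{x, y} \<in> diagonals n \<longleftrightarrow> y \<le> Suc n \<and> {x, y} \<notin> boundary_edges n"
  using assms by (auto simp: diagonals_def vertices_def)

lemma diagonals_subset: "d \<in> diagonals n \<Longrightarrow> d \<subseteq> vertices n \<and> card d = 2"
  by (simp add: diagonals_def)

lemma diagonal_cases:
  assumes "d \<in> diagonals n"
  obtains x y where "x < y" "y \<le> Suc n" "d = {x, y}"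
  using assms by (auto simp: diagonals_def elim!: vertex_pair_cases)

text \<open>One side of a boundary edge has no vertices: there are none between neighbours and none
  outside the range from \<open>0\<close> to \<open>Suc n\<close>.\<close>

lemma boundary_not_crosses:
  assumes "x < y" "{x, y} \<in> boundary_edges n" "v \<le> Suc n" "u < v"
  shows "\<not> crosses (x, y) (u, v)"
  using assms(2-4) unfolding boundary_edges_iff[OF assms(1)] crosses_iff by linarith

text \<open>The polygon is read as the interval from \<open>0\<close> to \<open>Suc n\<close>:
  two-element sets become increasing pairs, and the wrap-around edge becomes the outer
  chord.\<close>

definition all_chords :: "nat \<Rightarrow> nat set set \<Rightarrow> (nat \<times> nat) set" where
  "all_chords n T = {(x, y). x < y \<and> {x, y} \<in> boundary_edges n \<union> T}"

lemma all_chords_iff: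
  "(x, y) \<in> all_chords n T \<longleftrightarrow> x < y \<and> ({x, y} \<in> boundary_edges n \<or> {x, y} \<in> T)"
  by (simp add: all_chords_def)

text \<open>Boundary edges cross nothing, so adding them keeps the family non-crossing. A chord
  crossed by nothing is a boundary edge or, by maximality, a member of \<open>T\<close>.\<close>

lemma all_chords_full_triangulation:
  assumes "triangulation n T"
  shows "all_chords n T \<in> full_triangulations 0 (Suc n)"
  unfolding full_triangulations_iff
proof (intro allI iffI)
  have T: "T \<subseteq> diagonals n" "\<And>d e. d \<in> T \<Longrightarrow> e \<in> T \<Longrightarrow> \<not> crossing d e"
    "\<And>d. d \<in> diagonals n \<Longrightarrow> d \<notin> T \<Longrightarrow> \<exists>e\<in>T. crossing d e"
    using assms by (auto simp: triangulation_def)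
  have rng: "u < v \<and> v \<le> Suc n" if "(u, v) \<in> all_chords n T" for u v
  proof -
    have "u < v" using that by (simp add: all_chords_iff)
    then show ?thesis
      using that T(1) diagonals_iff[of u v n] boundary_edges_iff[of u v n]
      by (auto simp: all_chords_iff)
  qed
  fix x y
  {
    assume xy: "(x, y) \<in> all_chords n T"
    have "\<not> crosses (x, y) (u, v)" if uv: "(u, v) \<in> all_chords n T" for u v
    proof (cases "{x, y} \<in> boundary_edges n \<or> {u, v} \<in> boundary_edges n")
      case True
      then show ?thesis
        using boundary_not_crosses[of x y n v u] boundary_not_crosses[of u v n y x]
          rng[OF xy] rng[OF uv] crosses_sym by blast
    next
      case False
      then have "{x, y} \<in> T" "{u, v} \<in> T" using xy uv by (auto simp: all_chords_iff)
      then show ?thesis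
        using T(2) crossing_iff_crosses[of x y u v] rng[OF xy] rng[OF uv] by blast
    qed
    then show "0 \<le> x \<and> x < y \<and> y \<le> Suc n \<and> (\<forall>q\<in>all_chords n T. \<not> crosses (x, y) q)"
      using rng[OF xy] by auto
  next
    assume h: "0 \<le> x \<and> x < y \<and> y \<le> Suc n \<and> (\<forall>q\<in>all_chords n T. \<not> crosses (x, y) q)"
    show "(x, y) \<in> all_chords n T"
    proof (rule ccontr)
      assume no: "(x, y) \<notin> all_chords n T"
      then have "{x, y} \<in> diagonals n" "{x, y} \<notin> T"
        using h by (auto simp: all_chords_iff diagonals_iff)
      then obtain e where e: "e \<in> T" "crossing {x, y} e" using T(3) by blast
      then obtain u v where uv: "u < v" "e = {u, v}" using T(1) diagonal_cases by blast
      then have "(u, v) \<in> all_chords n T" "crosses (x, y) (u, v)"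
        using e h crossing_iff_crosses[of x y u v] by (auto simp: all_chords_iff)
      then show False using h by blast
    qed
  }
qed

lemma all_chords_surj:
  assumes U: "U \<in> full_triangulations 0 (Suc n)"
  obtains T where "triangulation n T" "all_chords n T = U"
proof
  \<comment> \<open>Removing the boundary edges is reversible, since a full triangulation contains
    all of them.\<close>
  define T where "T = {{x, y} | x y. (x, y) \<in> U} - boundary_edges n"
  note r = full_triangulation_range[OF U]
  have mem: "{x, y} \<in> T \<longleftrightarrow> (x, y) \<in> U \<and> {x, y} \<notin> boundary_edges n" if "x < y" for x y
    using that r(2) by (fastforce simp: T_def doubleton_eq_iff)
  have bd: "(x, y) \<in> U" if "x < y" "{x, y} \<in> boundary_edges n" for x y
    using that(2) full_triangulation_base[OF U] full_triangulation_step[OF U]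
    unfolding boundary_edges_iff[OF that(1)] by auto
  have T: "\<exists>x y. d = {x, y} \<and> x < y \<and> y \<le> Suc n \<and> (x, y) \<in> U \<and> {x, y} \<notin> boundary_edges n"
    if "d \<in> T" for d
    using that r(2,3) unfolding T_def by blast
  show "all_chords n T = U"
    using mem bd r(2) by (auto simp: all_chords_iff)
  show "triangulation n T"
    unfolding triangulation_def
  proof (intro conjI ballI)
    show "T \<subseteq> diagonals n"
      using T diagonals_iff by blast
  next
    fix d e assume "d \<in> T" "e \<in> T"
    then show "\<not> crossing d e"
      using T[of d] T[of e] full_triangulation_noncrossing[OF U] crossing_iff_crosses by metis
  next
    fix d assume d: "d \<in> diagonals n - T"
    then obtain x y where xy: "x < y" "y \<le> Suc n" "d = {x, y}" by (blast elim: diagonal_cases)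
    then have "(x, y) \<notin> U" "{x, y} \<notin> boundary_edges n"
      using d mem[of x y] by (auto simp: diagonals_iff)
    then obtain u v where uv: "(u, v) \<in> U" "crosses (x, y) (u, v)"
      using mem_full_triangulation[OF U, of x y] xy by auto
    then have "{u, v} \<notin> boundary_edges n"
      using boundary_not_crosses[of u v n y x] r[OF uv(1)] xy crosses_sym by blast
    then have "{u, v} \<in> T" using uv mem r(2) by blast
    moreover have "crossing d {u, v}"
      using uv crossing_iff_crosses[of x y u v] xy r(2) by blast
    ultimately show "\<exists>e\<in>T. crossing d e" by blast
  qed
qed

text \<open>Diagonals are never boundary edges, so \<open>T\<close> can be read off again.\<close>

lemma all_chords_inj: "inj_on (all_chords n) {T. triangulation n T}"
proof (rule inj_onI)
  have sub: "S \<subseteq> T" if T: "triangulation n T" and S: "triangulation n S"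
    and eq: "all_chords n S = all_chords n T" for S T
  proof
    fix d assume d: "d \<in> S"
    then have dd: "d \<in> diagonals n" using S by (auto simp: triangulation_def)
    then obtain x y where xy: "x < y" "d = {x, y}" by (blast elim: diagonal_cases)
    then have "(x, y) \<in> all_chords n T" using d eq[symmetric] by (simp add: all_chords_iff)
    then show "d \<in> T" using dd xy by (auto simp: all_chords_iff diagonals_iff)
  qed
  show "S = T" if "S \<in> {T. triangulation n T}" "T \<in> {T. triangulation n T}"
    "all_chords n S = all_chords n T" for S T
    using sub[of S T] sub[of T S] that by auto
qed

lemma card_three_cases:
  fixes t :: "nat set"
  assumes "card t = 3"
  obtains x y z where "x < y" "y < z" "t = {x, y, z}"
proof -
  obtain a b c where t: "t = {a, b, c}" and ne: "a \<noteq> b" "b \<noteq> c" "a \<noteq> c"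
    using assms by (auto simp: card_3_iff)
  have perm: "{a, b, c} = {a, c, b}" "{a, b, c} = {b, a, c}" "{a, b, c} = {b, c, a}"
    "{a, b, c} = {c, a, b}" "{a, b, c} = {c, b, a}" by auto
  consider "a < b" "b < c" | "a < c" "c < b" | "b < a" "a < c" | "b < c" "c < a" | "c < a" "a < b"
    | "c < b" "b < a"
    using ne by linarith
  then show ?thesis
    by cases (use that t perm in metis)+
qed

lemma card_three_one_of_three:
  assumes "x < y" "y < z"
  shows "card ({x, y, z} - B) = 2 \<and> card ({x, y, z} \<inter> B) = 1 \<longleftrightarrow> one_of_three B x y z"
  using assms by (auto simp: one_of_three_def insert_Diff_if)

lemma bw_colouring_iff_proper:
  assumes "triangulation n T"
  shows "bw_colouring n T B \<longleftrightarrow> B \<subseteq> {0..Suc n} \<and> proper (all_chords n T) B"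
proof -
  have V: "vertices n = {0..Suc n}" by (auto simp: vertices_def)
  have tri: "{x, y, z} \<in> triangles n T \<longleftrightarrow>
      (x, y) \<in> all_chords n T \<and> (y, z) \<in> all_chords n T \<and> (x, z) \<in> all_chords n T"
    if "x < y" "y < z" for x y z
  proof -
    have "z \<le> Suc n" if "(x, z) \<in> all_chords n T"
      using full_triangulation_range(3)[OF all_chords_full_triangulation[OF assms] that] .
    then show ?thesis
      using that by (auto simp: triangles_def V all_chords_iff insert_commute)
  qed
  have "(\<forall>t\<in>triangles n T. card (t - B) = 2 \<and> card (t \<inter> B) = 1) \<longleftrightarrow> proper (all_chords n T) B"
  proof
    assume L: "\<forall>t\<in>triangles n T. card (t - B) = 2 \<and> card (t \<inter> B) = 1"
    show "proper (all_chords n T) B"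
      unfolding proper_def
    proof (intro allI impI)
      fix x y z
      assume a: "(x, y) \<in> all_chords n T" "(y, z) \<in> all_chords n T" "(x, z) \<in> all_chords n T"
      then have o: "x < y" "y < z" by (auto simp: all_chords_iff)
      show "one_of_three B x y z"
        using L tri[OF o] a card_three_one_of_three[OF o] by blast
    qed
  next
    assume P: "proper (all_chords n T) B"
    show "\<forall>t\<in>triangles n T. card (t - B) = 2 \<and> card (t \<inter> B) = 1"
    proof
      fix t assume t: "t \<in> triangles n T"
      then have "card t = 3" by (simp add: triangles_def)
      then obtain x y z where o: "x < y" "y < z" and e: "t = {x, y, z}" by (rule card_three_cases)
      have "one_of_three B x y z"
        using P t tri[OF o] unfolding e proper_def by blast
      then show "card (t - B) = 2 \<and> card (t \<inter> B) = 1"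
        unfolding e card_three_one_of_three[OF o] .
    qed
  qed
  then show ?thesis by (simp add: bw_colouring_def V)
qed

section \<open>Counting over the edge between \<open>0\<close> and \<open>Suc n\<close>\<close>

definition end_colouring ::
  "nat \<Rightarrow> nat \<Rightarrow> nat \<Rightarrow> bool \<Rightarrow> bool \<Rightarrow> nat set set \<Rightarrow> nat set \<Rightarrow> bool" where
  "end_colouring n s e \<alpha> \<gamma> T B \<longleftrightarrow> bw_colouring n T B \<and> (s \<in> B) = \<alpha> \<and> (e \<in> B) = \<gamma>"

definition end_triangulations ::
  "nat \<Rightarrow> nat \<Rightarrow> nat \<Rightarrow> bool \<Rightarrow> bool \<Rightarrow> nat \<Rightarrow> nat \<Rightarrow> nat set set set" where
  "end_triangulations n s e \<alpha> \<gamma> b w =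
     {T. triangulation n T \<and>
         (\<exists>B. end_colouring n s e \<alpha> \<gamma> T B \<and> card B = b \<and> card (vertices n - B) = w)}"

text \<open>Reversing the marked edge turns white-black into black-white; this is why the end
  colours are parameters.\<close>

lemma end_colouring_swap: "end_colouring n s e \<alpha> \<gamma> = end_colouring n e s \<gamma> \<alpha>"
  by (auto simp: end_colouring_def fun_eq_iff)

lemma end_triangulations_swap: "end_triangulations n s e \<alpha> \<gamma> = end_triangulations n e s \<gamma> \<alpha>"
  by (simp add: end_triangulations_def end_colouring_swap[of n s] fun_eq_iff)

lemma end_colouring_iff_coloured:
  assumes "triangulation n T"
  shows "end_colouring n 0 (Suc n) \<alpha> \<gamma> T B \<longleftrightarrow> (all_chords n T, B) \<in> coloured \<alpha> \<gamma> 0 (Suc n)"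
  using all_chords_full_triangulation[OF assms]
  by (auto simp: end_colouring_def coloured_def bw_colouring_iff_proper[OF assms])

lemma end_colouring_base_unique:
  assumes "triangulation n T" "\<not> (\<alpha> \<and> \<gamma>)"
  shows "\<exists>!B. end_colouring n 0 (Suc n) \<alpha> \<gamma> T B"
  unfolding end_colouring_iff_coloured[OF assms(1)]
  using coloured_unique[OF all_chords_full_triangulation[OF assms(1)] _ assms(2)] by simp

text \<open>\<open>gen\<close> ignores the ends of the marked edge, of which at most one is black;
  hence the shift of \<open>b\<close>. Uniqueness of the colouring makes the projection from
  coloured pairs to triangulations injective.\<close>

lemma card_end_triangulations_base:
  assumes bw: "b + w = n + 2" and ends: "\<not> (\<alpha> \<and> \<gamma>)"
  shows "real (card (end_triangulations n 0 (Suc n) \<alpha> \<gamma> b w)) =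
    (if b < of_bool (\<alpha> \<or> \<gamma>) then 0 else gen \<alpha> \<gamma> $ n $ (b - of_bool (\<alpha> \<or> \<gamma>)))"
proof -
  define k :: nat where "k = of_bool (\<alpha> \<or> \<gamma>)"
  let ?Q = "coloured \<alpha> \<gamma> 0 (Suc n)"
  define S where "S = {(U, B) \<in> ?Q. card B = b}"
  have cardB: "card B = card (B \<inter> {0<..<Suc n}) + k" if "(U, B) \<in> ?Q" for U B
  proof -
    have B: "B \<subseteq> {0..Suc n}" "0 \<in> B \<longleftrightarrow> \<alpha>" "Suc n \<in> B \<longleftrightarrow> \<gamma>"
      using that by (auto simp: coloured_def)
    have "B = (B \<inter> {0<..<Suc n}) \<union> (if \<alpha> then {0} else {}) \<union> (if \<gamma> then {Suc n} else {})"
    proof (rule set_eqI)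
      fix v
      show "v \<in> B \<longleftrightarrow> v \<in> (B \<inter> {0<..<Suc n}) \<union> (if \<alpha> then {0} else {}) \<union> (if \<gamma> then {Suc n} else {})"
      proof (cases "v = 0 \<or> v = Suc n")
        case True
        then show ?thesis using B(2,3) by auto
      next
        case False
        then show ?thesis using B(1) by auto
      qed
    qed
    also have "card \<dots> = card (B \<inter> {0<..<Suc n}) + k"
      using ends by (auto simp: k_def)
    finally show ?thesis .
  qed
  have cardW: "card (vertices n - B) = w \<longleftrightarrow> card B = b" if "(U, B) \<in> ?Q" for U B
  proof -
    have B: "B \<subseteq> vertices n" using that by (auto simp: coloured_def vertices_def)
    then have "finite B" "card B \<le> n + 2"
      using card_mono[OF _ B] finite_subset[OF B] by (auto simp: vertices_def)
    then show ?thesis using bw B by (auto simp: card_Diff_subset) (auto simp: vertices_def)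
  qed
  have "all_chords n ` end_triangulations n 0 (Suc n) \<alpha> \<gamma> b w = fst ` S"
  proof
    show "all_chords n ` end_triangulations n 0 (Suc n) \<alpha> \<gamma> b w \<subseteq> fst ` S"
      unfolding S_def end_triangulations_def by (force simp: end_colouring_iff_coloured)
    show "fst ` S \<subseteq> all_chords n ` end_triangulations n 0 (Suc n) \<alpha> \<gamma> b w"
    proof
      fix U assume "U \<in> fst ` S"
      then obtain B where UB: "(U, B) \<in> ?Q" "card B = b" by (auto simp: S_def)
      then have "U \<in> full_triangulations 0 (Suc n)" by (auto simp: coloured_def)
      then obtain T where T: "triangulation n T" "all_chords n T = U" by (rule all_chords_surj)
      then have "T \<in> end_triangulations n 0 (Suc n) \<alpha> \<gamma> b w"
        using UB cardW[OF UB(1)] by (auto simp: end_triangulations_def end_colouring_iff_coloured)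
      then show "U \<in> all_chords n ` end_triangulations n 0 (Suc n) \<alpha> \<gamma> b w" using T by blast
    qed
  qed
  moreover have "inj_on fst S"
  proof (rule inj_onI)
    fix p q assume pq: "p \<in> S" "q \<in> S" "fst p = fst q"
    then obtain U B C where e: "p = (U, B)" "q = (U, C)" by (metis prod.collapse)
    then have "(U, B) \<in> ?Q" "(U, C) \<in> ?Q" using pq by (auto simp: S_def)
    moreover from this have "\<exists>!B. (U, B) \<in> ?Q"
      using coloured_unique[OF _ _ ends, of U 0 "Suc n"] by (auto simp: coloured_def)
    ultimately show "p = q" using e by blast
  qed
  moreover have "inj_on (all_chords n) (end_triangulations n 0 (Suc n) \<alpha> \<gamma> b w)"
    by (rule inj_on_subset[OF all_chords_inj]) (auto simp: end_triangulations_def)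
  ultimately have card: "card (end_triangulations n 0 (Suc n) \<alpha> \<gamma> b w) = card S"
    by (metis card_image)
  show ?thesis
  proof (cases "b < k")
    case True
    then have "S = {}" using cardB by (fastforce simp: S_def)
    then show ?thesis using True card by (simp add: k_def)
  next
    case False
    \<comment> \<open>Extracting the coefficient replaces each monomial by an indicator, so the sum
      counts the pairs with \<open>b\<close> black vertices.\<close>
    have "gen \<alpha> \<gamma> $ n $ (b - k) = (\<Sum>(U, B)\<in>?Q. of_bool (card (B \<inter> {0<..<Suc n}) = b - k))"
      by (simp add: gen_def weight_def fps_sum_nth case_prod_unfold fps_X_power_nth eq_commute of_bool_def)
    also have "\<dots> = (\<Sum>p\<in>?Q. of_bool (p \<in> S))"
      by (rule sum.cong) (use cardB False in \<open>auto simp: S_def\<close>)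
    also have "\<dots> = real (card (?Q \<inter> S))"
      by (simp add: finite_coloured of_bool_def sum.If_cases Int_def)
    also have "?Q \<inter> S = S" by (auto simp: S_def)
    finally show ?thesis using False card by (simp add: k_def)
  qed
qed

section \<open>Symmetries of the polygon\<close>

text \<open>Collects what triangulations and colourings depend on, with \<open>f\<close> acting on
  sets by image. Crossing is a cyclic notion, so rotations qualify although they do not preserve the
  order of the labels.\<close>

definition polygon_symmetry :: "nat \<Rightarrow> (nat \<Rightarrow> nat) \<Rightarrow> bool" where
  "polygon_symmetry n f \<longleftrightarrow>
     bij_betw f (vertices n) (vertices n) \<and>
     (\<forall>d\<subseteq>vertices n. f ` d \<in> boundary_edges n \<longleftrightarrow> d \<in> boundary_edges n) \<and>
     (\<forall>d\<subseteq>vertices n. \<forall>e\<subseteq>vertices n. card d = 2 \<longrightarrow> card e = 2 \<longrightarrow>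
        crossing (f ` d) (f ` e) = crossing d e)"

context
  fixes n f
  assumes f: "polygon_symmetry n f"
begin

lemma polygon_symmetry_bij: "bij_betw f (vertices n) (vertices n)"
  using f by (simp add: polygon_symmetry_def)

lemma polygon_symmetry_inj: "inj_on f (vertices n)"
  using polygon_symmetry_bij by (simp add: bij_betw_def)

lemma polygon_symmetry_mem: "v \<in> vertices n \<Longrightarrow> f v \<in> vertices n"
  using polygon_symmetry_bij by (auto simp: bij_betw_def)

lemma polygon_symmetry_image: "d \<subseteq> vertices n \<Longrightarrow> f ` d \<subseteq> vertices n"
  using polygon_symmetry_mem by auto

lemma polygon_symmetry_card: "d \<subseteq> vertices n \<Longrightarrow> card (f ` d) = card d"
  by (rule card_image) (rule inj_on_subset[OF polygon_symmetry_inj])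

lemma polygon_symmetry_boundary:
  "d \<subseteq> vertices n \<Longrightarrow> f ` d \<in> boundary_edges n \<longleftrightarrow> d \<in> boundary_edges n"
  using f by (simp add: polygon_symmetry_def)

lemma polygon_symmetry_crossing:
  "d \<subseteq> vertices n \<Longrightarrow> e \<subseteq> vertices n \<Longrightarrow> card d = 2 \<Longrightarrow> card e = 2 \<Longrightarrow>
     crossing (f ` d) (f ` e) \<longleftrightarrow> crossing d e"
  using f by (simp add: polygon_symmetry_def)

lemma polygon_symmetry_diagonals:
  "d \<subseteq> vertices n \<Longrightarrow> f ` d \<in> diagonals n \<longleftrightarrow> d \<in> diagonals n"
  by (simp add: diagonals_def polygon_symmetry_boundary polygon_symmetry_card polygon_symmetry_image)

lemma polygon_symmetry_inv_into:
  assumes "d \<subseteq> vertices n"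
  shows "inv_into (vertices n) f ` d \<subseteq> vertices n" "f ` inv_into (vertices n) f ` d = d"
    "inv_into (vertices n) f ` f ` d = d"
proof -
  have im: "f ` vertices n = vertices n"
    using polygon_symmetry_bij by (simp add: bij_betw_def)
  show "f ` inv_into (vertices n) f ` d = d"
    by (rule image_inv_into_cancel[OF im assms])
  show "inv_into (vertices n) f ` f ` d = d"
    by (rule inv_into_image_cancel[OF polygon_symmetry_inj assms])
  show "inv_into (vertices n) f ` d \<subseteq> vertices n"
    using assms im inv_into_into[of _ f "vertices n"] by blast
qed

lemma polygon_symmetry_inv: "polygon_symmetry n (inv_into (vertices n) f)"
proof -
  let ?g = "inv_into (vertices n) f"
  note g = polygon_symmetry_inv_into
  have c: "card (?g ` d) = card d" if "d \<subseteq> vertices n" for d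
    using polygon_symmetry_card[OF g(1)[OF that]] g(2)[OF that] by simp
  show ?thesis
    unfolding polygon_symmetry_def
  proof (intro conjI allI impI)
    show "bij_betw ?g (vertices n) (vertices n)"
      by (rule bij_betw_inv_into[OF polygon_symmetry_bij])
  next
    fix d assume d: "d \<subseteq> vertices n"
    show "?g ` d \<in> boundary_edges n \<longleftrightarrow> d \<in> boundary_edges n"
      using polygon_symmetry_boundary[OF g(1)[OF d]] g(2)[OF d] by simp
  next
    fix d e assume d: "d \<subseteq> vertices n" "e \<subseteq> vertices n" "card d = 2" "card e = 2"
    show "crossing (?g ` d) (?g ` e) = crossing d e"
      using polygon_symmetry_crossing[OF g(1)[OF d(1)] g(1)[OF d(2)]] d c g(2) by simp
  qed
qed

lemma polygon_symmetry_triangulation: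
  assumes T: "triangulation n T"
  shows "triangulation n ((`) f ` T)"
  unfolding triangulation_def
proof (intro conjI ballI)
  have sub: "d \<subseteq> vertices n \<and> card d = 2 \<and> d \<in> diagonals n" if "d \<in> T" for d
    using T that diagonals_subset by (auto simp: triangulation_def)
  show "(`) f ` T \<subseteq> diagonals n"
    using sub polygon_symmetry_diagonals by auto
  show "\<not> crossing d e" if "d \<in> (`) f ` T" "e \<in> (`) f ` T" for d e
    using that T sub polygon_symmetry_crossing by (auto simp: triangulation_def)
  show "\<exists>e\<in>(`) f ` T. crossing d e" if d: "d \<in> diagonals n - (`) f ` T" for d
  proof -
    \<comment> \<open>Maximality is pulled back: the preimage of a diagonal missing from the image
      is missing from \<open>T\<close>, so a member of \<open>T\<close> crosses it.\<close>
    define d' where "d' = inv_into (vertices n) f ` d"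
    have ds: "d \<subseteq> vertices n" using d diagonals_subset by blast
    have d': "d' \<subseteq> vertices n" "f ` d' = d"
      unfolding d'_def by (rule polygon_symmetry_inv_into[OF ds])+
    have "d' \<in> diagonals n - T"
      using d d' polygon_symmetry_diagonals[OF d'(1)] by auto
    then obtain e where e: "e \<in> T" "crossing d' e" using T unfolding triangulation_def by blast
    have "crossing (f ` d') (f ` e)"
      using polygon_symmetry_crossing[of d' e] e d' sub[OF e(1)] diagonals_subset \<open>d' \<in> diagonals n - T\<close>
      by blast
    then show ?thesis using e(1) d' by blast
  qed
qed

lemma polygon_symmetry_mem_image:
  "v \<in> vertices n \<Longrightarrow> B \<subseteq> vertices n \<Longrightarrow> f v \<in> f ` B \<longleftrightarrow> v \<in> B"
  by (rule inj_on_image_mem_iff[OF polygon_symmetry_inj])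

lemma polygon_symmetry_bw_colouring:
  assumes T: "triangulation n T" and B: "bw_colouring n T B"
  shows "bw_colouring n ((`) f ` T) (f ` B)"
  unfolding bw_colouring_def
proof (intro conjI ballI)
  have Bs: "B \<subseteq> vertices n" using B by (simp add: bw_colouring_def)
  show "f ` B \<subseteq> vertices n" by (rule polygon_symmetry_image[OF Bs])
  fix t assume t: "t \<in> triangles n ((`) f ` T)"
  \<comment> \<open>Triangles of the image are pulled back to triangles of \<open>T\<close>, where
    the colour condition is known.\<close>
  define t' where "t' = inv_into (vertices n) f ` t"
  have ts: "t \<subseteq> vertices n" using t by (simp add: triangles_def)
  have t': "t' \<subseteq> vertices n" "f ` t' = t"
    unfolding t'_def by (rule polygon_symmetry_inv_into[OF ts])+
  have "t' \<in> triangles n T"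
    unfolding triangles_def
  proof (intro CollectI conjI ballI impI)
    show "t' \<subseteq> vertices n" by fact
    show "card t' = 3" using polygon_symmetry_card[OF t'(1)] t t' by (simp add: triangles_def)
    fix x y assume xy: "x \<in> t'" "y \<in> t'" "x \<noteq> y"
    then have V: "{x, y} \<subseteq> vertices n" using t' by auto
    have "f x \<noteq> f y" using xy V inj_onD[OF polygon_symmetry_inj] by blast
    moreover have "f x \<in> t" "f y \<in> t" using xy t' by auto
    ultimately have "f ` {x, y} \<in> boundary_edges n \<union> (`) f ` T"
      using t by (simp add: triangles_def)
    moreover have "{x, y} \<in> T" if "f ` {x, y} \<in> (`) f ` T"
    proof -
      obtain d where d: "d \<in> T" "f ` {x, y} = f ` d" using \<open>f ` {x, y} \<in> (`) f ` T\<close> by blast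
      then have "d \<subseteq> vertices n" using T diagonals_subset by (auto simp: triangulation_def)
      then have "{x, y} = d"
        using d(2) inj_on_image_eq_iff[OF polygon_symmetry_inj V] by blast
      then show ?thesis using d(1) by simp
    qed
    ultimately show "{x, y} \<in> boundary_edges n \<union> T"
      using polygon_symmetry_boundary[OF V] by blast
  qed
  then have c: "card (t' - B) = 2" "card (t' \<inter> B) = 1" using B by (auto simp: bw_colouring_def)
  have "t - f ` B = f ` (t' - B)"
    unfolding t'(2)[symmetric] using inj_on_image_set_diff[OF polygon_symmetry_inj, of t' B] t'(1) Bs by blast
  moreover have "t \<inter> f ` B = f ` (t' \<inter> B)"
    unfolding t'(2)[symmetric] using inj_on_image_Int[OF polygon_symmetry_inj t'(1) Bs] by simp
  moreover have "t' - B \<subseteq> vertices n" "t' \<inter> B \<subseteq> vertices n" using t'(1) by auto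
  ultimately show "card (t - f ` B) = 2" "card (t \<inter> f ` B) = 1"
    using c polygon_symmetry_card by auto
qed

lemma polygon_symmetry_end_colouring:
  assumes "triangulation n T" "end_colouring n s e \<alpha> \<gamma> T B" "s \<in> vertices n" "e \<in> vertices n"
  shows "end_colouring n (f s) (f e) \<alpha> \<gamma> ((`) f ` T) (f ` B)"
  using assms polygon_symmetry_bw_colouring polygon_symmetry_mem_image
  by (auto simp: end_colouring_def bw_colouring_def)

text \<open>An injection suffices here; the reverse inequality comes from the inverse
  symmetry.\<close>

lemma polygon_symmetry_card_le:
  assumes "s \<in> vertices n" "e \<in> vertices n"
  shows "card (end_triangulations n s e \<alpha> \<gamma> b w) \<le> card (end_triangulations n (f s) (f e) \<alpha> \<gamma> b w)"
proof (rule card_inj_on_le)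
  have fin: "finite (Pow (Pow (vertices n)))" by (simp add: vertices_def)
  have sub: "T \<in> Pow (Pow (vertices n))" if "triangulation n T" for T
    using that diagonals_subset by (auto simp: triangulation_def)
  show "finite (end_triangulations n (f s) (f e) \<alpha> \<gamma> b w)"
    by (rule finite_subset[OF _ fin]) (use sub in \<open>auto simp: end_triangulations_def\<close>)
  have "inj_on ((`) ((`) f)) (Pow (Pow (vertices n)))"
    by (intro inj_on_image_Pow polygon_symmetry_inj)
  then show "inj_on ((`) ((`) f)) (end_triangulations n s e \<alpha> \<gamma> b w)"
    by (rule inj_on_subset) (use sub in \<open>auto simp: end_triangulations_def\<close>)
  show "(`) ((`) f) ` end_triangulations n s e \<alpha> \<gamma> b w \<subseteq> end_triangulations n (f s) (f e) \<alpha> \<gamma> b w"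
  proof (rule image_subsetI)
    fix T assume "T \<in> end_triangulations n s e \<alpha> \<gamma> b w"
    then obtain B where T: "triangulation n T" and B: "end_colouring n s e \<alpha> \<gamma> T B"
      and c: "card B = b" "card (vertices n - B) = w"
      by (auto simp: end_triangulations_def)
    have Bs: "B \<subseteq> vertices n" using B by (simp add: end_colouring_def bw_colouring_def)
    have "vertices n - f ` B = f ` (vertices n - B)"
      using inj_on_image_set_diff[OF polygon_symmetry_inj, of "vertices n" B] Bs polygon_symmetry_bij
      by (simp add: bij_betw_def)
    then have "card (f ` B) = b" "card (vertices n - f ` B) = w"
      using polygon_symmetry_card[OF Bs] polygon_symmetry_card[of "vertices n - B"] c by auto
    then show "(`) f ` T \<in> end_triangulations n (f s) (f e) \<alpha> \<gamma> b w"
      using polygon_symmetry_triangulation[OF T] polygon_symmetry_end_colouring[OF T B assms]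
      by (auto simp: end_triangulations_def)
  qed
qed

end

lemma polygon_symmetry_card_end_triangulations:
  assumes f: "polygon_symmetry n f" and V: "s \<in> vertices n" "e \<in> vertices n"
  shows "card (end_triangulations n s e \<alpha> \<gamma> b w) = card (end_triangulations n (f s) (f e) \<alpha> \<gamma> b w)"
proof (rule antisym)
  let ?g = "inv_into (vertices n) f"
  show "card (end_triangulations n s e \<alpha> \<gamma> b w) \<le> card (end_triangulations n (f s) (f e) \<alpha> \<gamma> b w)"
    by (rule polygon_symmetry_card_le[OF f V])
  have "?g (f s) = s" "?g (f e) = e"
    using V polygon_symmetry_inj[OF f] by auto
  then show "card (end_triangulations n (f s) (f e) \<alpha> \<gamma> b w) \<le> card (end_triangulations n s e \<alpha> \<gamma> b w)"
    using polygon_symmetry_card_le[OF polygon_symmetry_inv[OF f], of "f s" "f e" \<alpha> \<gamma> b w]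
      polygon_symmetry_mem[OF f] V by simp
qed

text \<open>Existence is carried back along the inverse of \<open>f\<close>, uniqueness forward
  along \<open>f\<close>.\<close>

lemma polygon_symmetry_end_colouring_unique:
  assumes f: "polygon_symmetry n f" and V: "s \<in> vertices n" "e \<in> vertices n"
    and T: "triangulation n T" and ex1: "\<exists>!B. end_colouring n (f s) (f e) \<alpha> \<gamma> ((`) f ` T) B"
  shows "\<exists>!B. end_colouring n s e \<alpha> \<gamma> T B"
proof -
  let ?g = "inv_into (vertices n) f"
  have g: "?g (f s) = s" "?g (f e) = e"
    using V polygon_symmetry_inj[OF f] by auto
  have "?g ` f ` d = d" if "d \<in> T" for d
    by (rule polygon_symmetry_inv_into(3)[OF f])
       (use T diagonals_subset that in \<open>auto simp: triangulation_def\<close>)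
  then have gT: "(`) ?g ` (`) f ` T = T"
    unfolding image_image by simp
  obtain B where "end_colouring n (f s) (f e) \<alpha> \<gamma> ((`) f ` T) B" using ex1 by blast
  then have "end_colouring n s e \<alpha> \<gamma> T (?g ` B)"
    using polygon_symmetry_end_colouring[OF polygon_symmetry_inv[OF f]
        polygon_symmetry_triangulation[OF f T], of "f s" "f e" \<alpha> \<gamma> B]
      polygon_symmetry_mem[OF f] V by (simp only: g gT)
  moreover have "B1 = B2" if "end_colouring n s e \<alpha> \<gamma> T B1" "end_colouring n s e \<alpha> \<gamma> T B2" for B1 B2
  proof -
    have "f ` B1 = f ` B2"
      using ex1 polygon_symmetry_end_colouring[OF f T that(1) V]
        polygon_symmetry_end_colouring[OF f T that(2) V] by blast
    then show ?thesis
      using that inj_on_image_eq_iff[OF polygon_symmetry_inj[OF f]]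
      by (auto simp: end_colouring_def bw_colouring_def)
  qed
  ultimately show ?thesis by blast
qed

lemma polygon_symmetry_comp:
  assumes "polygon_symmetry n f" "polygon_symmetry n g"
  shows "polygon_symmetry n (f \<circ> g)"
  unfolding polygon_symmetry_def
proof (intro conjI allI impI)
  show "bij_betw (f \<circ> g) (vertices n) (vertices n)"
    using assms polygon_symmetry_bij bij_betw_trans by blast
qed (simp_all only: image_comp[symmetric] polygon_symmetry_image[OF assms(2)]
    polygon_symmetry_boundary[OF assms(1)] polygon_symmetry_boundary[OF assms(2)]
    polygon_symmetry_crossing[OF assms(1)] polygon_symmetry_crossing[OF assms(2)]
    polygon_symmetry_card[OF assms(2)])

lemma polygon_symmetry_id: "polygon_symmetry n id"
  by (simp add: polygon_symmetry_def)

section \<open>Rotations and arbitrary marked edges\<close>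

definition rot :: "nat \<Rightarrow> nat \<Rightarrow> nat" where
  "rot n v = (v + 1) mod (n + 2)"

lemma rot_eq: "v \<le> Suc n \<Longrightarrow> rot n v = (if v = Suc n then 0 else Suc v)"
  by (simp add: rot_def)

lemma rot_symmetry: "polygon_symmetry n (rot n)"
  unfolding polygon_symmetry_def
proof (intro conjI allI impI)
  show bij: "bij_betw (rot n) (vertices n) (vertices n)"
    by (rule bij_betw_byWitness[of _ "\<lambda>v. if v = 0 then Suc n else v - 1"])
       (auto simp: vertices_def rot_eq)
  fix d assume d: "d \<subseteq> vertices n"
  have b: "boundary_edges n = (\<lambda>i. {i, rot n i}) ` vertices n"
    by (auto simp: boundary_edges_def rot_def vertices_def)
  have r: "rot n v \<in> vertices n" for v by (simp add: rot_def vertices_def)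
  show "rot n ` d \<in> boundary_edges n \<longleftrightarrow> d \<in> boundary_edges n"
  proof
    assume "d \<in> boundary_edges n"
    then show "rot n ` d \<in> boundary_edges n" unfolding b using r by auto
  next
    assume "rot n ` d \<in> boundary_edges n"
    then obtain j where j: "j \<in> vertices n" "rot n ` d = {j, rot n j}" unfolding b by auto
    then obtain i where i: "i \<in> vertices n" "j = rot n i" using bij by (auto simp: bij_betw_def)
    then have "rot n ` d = rot n ` {i, rot n i}" using j by simp
    then have "d = {i, rot n i}"
      using inj_on_image_eq_iff[of "rot n" "vertices n" d "{i, rot n i}"] bij d i r
      by (simp add: bij_betw_def)
    then show "d \<in> boundary_edges n" unfolding b using i by blast
  qed
next
  fix d e assume *: "d \<subseteq> vertices n" "e \<subseteq> vertices n" "card d = 2" "card e = 2"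
  obtain x y where xy: "x < y" "y \<le> Suc n" "d = {x, y}" using vertex_pair_cases[OF *(1,3)] .
  obtain u v where uv: "u < v" "v \<le> Suc n" "e = {u, v}" using vertex_pair_cases[OF *(2,4)] .
  \<comment> \<open>When the larger endpoint wraps to \<open>0\<close>, the pair is relisted in
    increasing order, as the comparison with \<open>crosses\<close> requires.\<close>
  have rd: "rot n ` d = (if y = Suc n then {0, Suc x} else {Suc x, Suc y})"
    using xy by (auto simp: rot_eq)
  have re: "rot n ` e = (if v = Suc n then {0, Suc u} else {Suc u, Suc v})"
    using uv by (auto simp: rot_eq)
  show "crossing (rot n ` d) (rot n ` e) = crossing d e"
    unfolding rd re using xy uv by (auto simp: crossing_iff_crosses crosses_iff)
qed

lemma boundary_edge_to_base:
  assumes "{s, e} \<in> boundary_edges n"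
  obtains f where "polygon_symmetry n f" "f s = 0 \<and> f e = Suc n \<or> f s = Suc n \<and> f e = 0"
proof -
  \<comment> \<open>Downward induction from the wrap-around edge, which starts at
    \<open>Suc n\<close>: one rotation takes the edge at \<open>i\<close> to the edge at
    \<open>Suc i\<close>. As \<open>{s, e}\<close> is unordered, either orientation may
    result.\<close>
  have *: "\<exists>f. polygon_symmetry n f \<and> f i = Suc n \<and> f (rot n i) = 0" if "i \<le> Suc n" for i
    using that
  proof (induction i rule: inc_induct)
    case base
    then show ?case using polygon_symmetry_id[of n] by (intro exI[of _ id]) (simp add: rot_eq id_def)
  next
    case (step i)
    then obtain f where f: "polygon_symmetry n f" "f (Suc i) = Suc n" "f (rot n (Suc i)) = 0" by blast
    then show ?case
      using step.hyps
      by (intro exI[of _ "f \<circ> rot n"] conjI polygon_symmetry_comp[OF f(1) rot_symmetry])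
         (simp_all add: rot_eq[of i])
  qed
  obtain i where "i < n + 2" and i2: "{s, e} = {i, rot n i}"
    using assms unfolding boundary_edges_def rot_def by blast
  then have i: "i \<le> Suc n" by simp
  obtain f where f: "polygon_symmetry n f" "f i = Suc n" "f (rot n i) = 0" using *[OF i] by blast
  show ?thesis
    by (rule that[OF f(1)]) (use f i2 in \<open>auto simp: doubleton_eq_iff\<close>)
qed

lemma boundary_edge_vertices:
  "{s, e} \<in> boundary_edges n \<Longrightarrow> s \<in> vertices n \<and> e \<in> vertices n"
  by (auto simp: boundary_edges_def vertices_def doubleton_eq_iff)

lemma end_colouring_unique:
  assumes se: "{s, e} \<in> boundary_edges n" and T: "triangulation n T" and ends: "\<not> (\<alpha> \<and> \<gamma>)"
  shows "\<exists>!B. end_colouring n s e \<alpha> \<gamma> T B"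
proof -
  obtain f where f: "polygon_symmetry n f" "f s = 0 \<and> f e = Suc n \<or> f s = Suc n \<and> f e = 0"
    using boundary_edge_to_base[OF se] .
  note T' = polygon_symmetry_triangulation[OF f(1) T]
  have "\<exists>!B. end_colouring n (f s) (f e) \<alpha> \<gamma> ((`) f ` T) B"
    using f(2)
  proof
    assume "f s = 0 \<and> f e = Suc n"
    then show ?thesis using end_colouring_base_unique[OF T' ends] by simp
  next
    assume "f s = Suc n \<and> f e = 0"
    moreover have "\<exists>!B. end_colouring n 0 (Suc n) \<gamma> \<alpha> ((`) f ` T) B"
      by (rule end_colouring_base_unique[OF T']) (use ends in blast)
    ultimately show ?thesis
      by (simp only: end_colouring_swap[of n "Suc n" 0 \<alpha> \<gamma>])
  qed
  then show ?thesis
    using boundary_edge_vertices[OF se] by (intro polygon_symmetry_end_colouring_unique[OF f(1) _ _ T]) simp_all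
qed

text \<open>The rotation may bring the edge to the base reversed. The end colours are then swapped,
  and by \<open>gen_reverse\<close> the series is the same.\<close>

lemma card_end_triangulations:
  assumes bw: "b + w = n + 2" and se: "{s, e} \<in> boundary_edges n" and ends: "\<not> (\<alpha> \<and> \<gamma>)"
  shows "real (card (end_triangulations n s e \<alpha> \<gamma> b w)) =
    (if b < of_bool (\<alpha> \<or> \<gamma>) then 0 else gen \<alpha> \<gamma> $ n $ (b - of_bool (\<alpha> \<or> \<gamma>)))"
proof -
  obtain f where f: "polygon_symmetry n f" "f s = 0 \<and> f e = Suc n \<or> f s = Suc n \<and> f e = 0"
    using boundary_edge_to_base[OF se] .
  have sym: "gen \<gamma> \<alpha> = gen \<alpha> \<gamma>"
    using ends gen_reverse by (cases \<alpha>; cases \<gamma>) auto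
  have "card (end_triangulations n s e \<alpha> \<gamma> b w) = card (end_triangulations n (f s) (f e) \<alpha> \<gamma> b w)"
    using polygon_symmetry_card_end_triangulations[OF f(1)] boundary_edge_vertices[OF se] by blast
  then show ?thesis
    using f(2) card_end_triangulations_base[OF bw, of \<alpha> \<gamma>] card_end_triangulations_base[OF bw, of \<gamma> \<alpha>]
      ends sym end_triangulations_swap[of n "Suc n" 0 \<alpha> \<gamma>]
    by (auto simp: disj_commute)
qed

text \<open>As \<open>b + w\<close> is at least 2, the denominators vanish only for
  \<open>w = 1\<close> in (i) and for \<open>b = 0\<close>, \<open>w = 2\<close> in both parts. The
  formulas have no value there, so these counts are given separately.\<close>

theorem theorem2:
  fixes n b w s e :: nat
  assumes "b + w = n + 2"
    and "{s, e} \<in> boundary_edges n"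
  shows
    "(\<forall>T. triangulation n T \<longrightarrow> (\<exists>!B. ww_colouring n s e T B) \<and> (\<exists>!B. wb_colouring n s e T B)) \<and>
     ((real w - 1) * (2 * real b + real w - 2) \<noteq> 0 \<longrightarrow>
        real (card (ww_triangulations n s e b w)) =
          2 * real b / ((real w - 1) * (2 * real b + real w - 2)) *
            binom (2 * int b + int w - 2) (int w - 2) * binom (int w - 1) (int b)) \<and>
     (w = 1 \<longrightarrow> card (ww_triangulations n s e b w) = 0) \<and>
     (b = 0 \<and> w = 2 \<longrightarrow> card (ww_triangulations n s e b w) = 1) \<and>
     (2 * real b + real w - 2 \<noteq> 0 \<longrightarrow>
        real (card (wb_triangulations n s e b w)) =
          1 / (2 * real b + real w - 2) *
            binom (2 * int b + int w - 2) (int w - 1) * binom (int w - 1) (int b - 1)) \<and>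
     (b = 0 \<and> w = 2 \<longrightarrow> card (wb_triangulations n s e b w) = 0)"
proof -
  have col: "ww_colouring n s e = end_colouring n s e False False"
    "wb_colouring n s e = end_colouring n s e False True"
    by (auto simp: ww_colouring_def wb_colouring_def end_colouring_def fun_eq_iff)
  have tri: "ww_triangulations n s e b w = end_triangulations n s e False False b w"
    "wb_triangulations n s e b w = end_triangulations n s e False True b w"
    by (simp_all add: ww_triangulations_def wb_triangulations_def end_triangulations_def col)
  have ww: "real (card (ww_triangulations n s e b w)) = gen False False $ n $ b"
    using card_end_triangulations[OF assms, of False False] by (simp add: tri)
  have wb: "real (card (wb_triangulations n s e b w)) =
      (if b = 0 then 0 else gen False True $ n $ (b - 1))"
    using card_end_triangulations[OF assms, of False True] by (simp add: tri)
  have "\<forall>T. triangulation n T \<longrightarrow> (\<exists>!B. ww_colouring n s e T B) \<and> (\<exists>!B. wb_colouring n s e T B)"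
    unfolding col using end_colouring_unique[OF assms(2)] by simp
  moreover have "card (ww_triangulations n s e b w) = 0" if "w = 1"
  proof -
    have "gen False False $ n $ b = 0"
      \<comment> \<open>Here \<open>b = n + 1\<close>, which lies beyond the range of nonzero
        coefficients.\<close>
      using assms(1) that unfolding gen_white_white_nth_power gen_power_nth by (cases n) auto
    then show ?thesis using ww by simp
  qed
  moreover have "card (ww_triangulations n s e b w) = 1" if "b = 0 \<and> w = 2"
    using ww assms(1) that unfolding gen_white_white_nth_power by simp
  moreover have "card (wb_triangulations n s e b w) = 0" if "b = 0 \<and> w = 2"
    using wb that by simp
  ultimately show ?thesis
    using gen_white_white_nth[OF assms(1)] gen_white_black_nth[OF assms(1)] ww wb by simp
qed

end
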